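(* For each $n\ge2$ let $a_n,b_n>-1$, $\beta_n>0$, and let $\lambda_1^{(n)}\le\dots\le\lambda_n^{(n)}$ be the order statistics of a random vector with the Jacobi ensemble density $$f_n(\lambda)=c_n\prod_{i<j}|\lambda_i-\lambda_j|^{\beta_n}\prod_{i=1}^n(2-\lambda_i)^{a_n}(2+\lambda_i)^{b_n}\,I_{(-2,2)}(\lambda_i)$$ ($c_n$ the normalizing constant), all these random vectors being defined on a common probability space. Let $\tilde a_n=(2a_n+2)/\beta_n$, $\tilde b_n=(2b_n+2)/\beta_n$ and let $x_1^{(n)}<\dots<x_n^{(n)}$ be the ordered roots of $x\mapsto P_n^{(\tilde a_n-1,\tilde b_n-1)}(\tfrac12x)$. If $\lim_{n\to\infty}(a_n+b_n)/\log n=\infty$, then there is an almost surely finite random variable $S$ such that $$\max_{1\le j\le n}|\lambda_j^{(n)}-x_j^{(n)}|\le\Big(\frac{\log n}{a_n+b_n}\Big)^{1/4}S$$ for all $n\ge2$. In particular, if $\liminf_{n\to\infty}(a_n+b_n)/n>0$, then there is an almost surely finite random variable $S'$ such that almost surely $\max_{1\le j\le n}|\lambda_j^{(n)}-x_j^{(n)}|\le(\log n/n)^{1/4}S'$ for all $n\ge2$.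
   Context: For $\gamma,\delta>-1$, $P_n^{(\gamma,\delta)}$ denotes the Jacobi polynomial of degree $n$: the polynomial of degree $n$ with leading coefficient $(n+\gamma+\delta+1)_n/(2^n n!)$ (with $(a)_n=\Gamma(a+n)/\Gamma(a)$) such that $\int_{-1}^1P_n^{(\gamma,\delta)}(x)P_m^{(\gamma,\delta)}(x)(1-x)^\gamma(1+x)^\delta\,dx=0$ for $m\ne n$.
   Formalization: The first bound is asserted for those n≥2 with a_n+b_n>0; for the finitely many other n the factor (log n/(a_n+b_n))^{1/4} is undefined (division by zero or fourth root of a negative number). *)

theory Defs
  imports "HOL-Probability.Probability" "HOL-Computational_Algebra.Polynomial"
begin

definition jacobi_family_spec :: "real \<Rightarrow> real \<Rightarrow> (nat \<Rightarrow> real poly) \<Rightarrow> bool" where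
  "jacobi_family_spec \<gamma> \<delta> P \<longleftrightarrow>
     (\<forall>n. degree (P n) = n \<and>
          lead_coeff (P n) = pochhammer (real n + \<gamma> + \<delta> + 1) n / (2 ^ n * fact n)) \<and>
     (\<forall>n m. n \<noteq> m \<longrightarrow>
        (LBINT x=-1..1. poly (P n) x * poly (P m) x * (1 - x) powr \<gamma> * (1 + x) powr \<delta>) = 0)"

definition jacobiP :: "nat \<Rightarrow> real \<Rightarrow> real \<Rightarrow> real poly" where
  "jacobiP n \<gamma> \<delta> = (THE P. jacobi_family_spec \<gamma> \<delta> P) n"

definition jacobi_weight :: "nat \<Rightarrow> real \<Rightarrow> real \<Rightarrow> real \<Rightarrow> (nat \<Rightarrow> real) \<Rightarrow> real" where
  "jacobi_weight n a b \<beta> v =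
     (\<Prod>i<n. \<Prod>j\<in>{i<..<n}. \<bar>v i - v j\<bar> powr \<beta>) *
     (\<Prod>i<n. (2 - v i) powr a * (2 + v i) powr b * indicator {-2<..<2} (v i))"

definition jacobi_density :: "nat \<Rightarrow> real \<Rightarrow> real \<Rightarrow> real \<Rightarrow> (nat \<Rightarrow> real) \<Rightarrow> ennreal" where
  "jacobi_density n a b \<beta> v =
     ennreal (jacobi_weight n a b \<beta> v) /
       (\<integral>\<^sup>+ u. ennreal (jacobi_weight n a b \<beta> u) \<partial>(PiM {..<n} (\<lambda>_. lborel)))"

definition order_stat :: "nat \<Rightarrow> (nat \<Rightarrow> real) \<Rightarrow> nat \<Rightarrow> real" where
  "order_stat n v j = sort (map v [0..<n]) ! (j - 1)"

definition ordered_root_half :: "real poly \<Rightarrow> nat \<Rightarrow> real" where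
  "ordered_root_half p j = sorted_list_of_set {x. poly p (x / 2) = 0} ! (j - 1)"

end

theory Submission
  imports Defs "HOL-Real_Asymp.Real_Asymp"
begin

text \<open>
  By Stieltjes, the rescaled Jacobi zeros \<open>x\<close> are the critical point of
  \<open>G = \<Prod>|\<lambda>\<^sub>i - \<lambda>\<^sub>j|^\<beta> \<Prod>(2 - \<lambda>\<^sub>i)^(a+1) (2 + \<lambda>\<^sub>i)^(b+1)\<close>, whereas the density carries the exponents
  \<open>a\<close> and \<open>b\<close>. Let \<open>\<phi>\<close> be nondecreasing, vanishing below a threshold \<open>c\<close>, and move the particle \<open>i\<close>
  by \<open>\<tau> \<phi>(\<lambda>\<^sub>i - x\<^sub>i)\<close>. The repulsion terms \<open>1 / (\<lambda>\<^sub>i - \<lambda>\<^sub>j)\<close>, compared with \<open>1 / (x\<^sub>i - x\<^sub>j)\<close>, enter with a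
  favourable sign because \<open>\<phi>\<close> is monotone, so only the one-particle force remains: the density
  decreases by a factor \<open>exp (- \<kappa> c \<tau> \<Sum>\<phi>)\<close> with \<open>\<kappa>\<close> proportional to \<open>a + b\<close>, while the Jacobian is only
  \<open>\<Prod>(1 + \<tau> \<phi>')\<close>. For \<open>\<phi> t = cosh (\<theta> (t - c)) - 1\<close> with \<open>\<theta> = \<kappa> c / 2\<close> the change of variables yields a
  bound of order \<open>n\<close> for \<open>\<Sum>\<phi>(\<lambda>\<^sub>i - x\<^sub>i)\<close>, free of the dimension otherwise. Taking
  \<open>c\<^sup>2 = 512 log n / (a + b)\<close> makes the probability of a deviation \<open>2 c\<close> at most \<open>16 / n\<^sup>3\<close>, and Borel-Cantelli applies.

  When \<open>a\<close> is small the mismatch between \<open>a\<close> and \<open>a + 1\<close> is not compensated at the edge \<open>2\<close>. There the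
  topmost \<open>k \<approx> 1 / \<beta>\<close> particles are left in place: their targets lie within \<open>O(log n / b)\<close> of the edge,
  so they cannot deviate upwards, and their repulsion acts on the remaining particles like a
  wall with exponent \<open>a + k \<beta> \<ge> 1\<close>. Downward deviations follow by reflection.
\<close>

section \<open>Zeros of the Jacobi polynomials\<close>

definition jacobi_functional :: "real \<Rightarrow> real \<Rightarrow> real poly \<Rightarrow> real" where
  "jacobi_functional \<gamma> \<delta> p = (LBINT x=-1..1. poly p x * ((1 - x) powr \<gamma> * (1 + x) powr \<delta>))"

lemma einterval_minus_one_one: "einterval (-1) 1 = {-1<..<1::real}"
  by (auto simp: einterval_def one_ereal_def uminus_ereal.simps[symmetric] simp del: uminus_ereal.simps)
     (simp_all add: one_ereal_def)

text \<open>The substitution t = (1 + x) / 2 turns the weight into a Beta integrand with parameters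
  \<delta> + 1 and \<gamma> + 1, and the polynomial factor is bounded on the compact
  interval.\<close>

lemma jacobi_weight_function_integrable:
  fixes \<gamma> \<delta> :: real
  assumes "\<gamma> > -1" "\<delta> > -1"
  shows "integrable lborel (\<lambda>x. indicator {-1<..<1} x * (poly p x * ((1 - x) powr \<gamma> * (1 + x) powr \<delta>)))"
proof -
  have "set_integrable lborel {0..1} (\<lambda>t. t powr (\<delta> + 1 - 1) * (1 - t) powr (\<gamma> + 1 - 1))"
    using assms integrable_Beta[of "\<delta> + 1" "\<gamma> + 1"] by simp
  then have "integrable lborel (\<lambda>t. indicator {0..1} t *\<^sub>R (t powr \<delta> * (1 - t) powr \<gamma>))"
    by (simp add: set_integrable_def)
  from lborel_integrable_real_affine[OF this, of "1/2" "1/2"]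
  have "integrable lborel (\<lambda>x. indicator {-1..1} x * (((1 + x) / 2) powr \<delta> * ((1 - x) / 2) powr \<gamma>))"
    by (rule back_subst[where P = "integrable lborel"]) (auto simp: indicator_def fun_eq_iff field_simps)
  then have I: "integrable lborel (\<lambda>x. (2 powr \<delta> * 2 powr \<gamma>) * (indicator {-1..1} x * (((1 + x) / 2) powr \<delta> * ((1 - x) / 2) powr \<gamma>)))"
    by (rule integrable_mult_right)
  have "bounded (poly p ` {-1..1})"
    by (intro compact_imp_bounded compact_continuous_image continuous_intros) auto
  then have "\<exists>B. \<forall>x\<in>{-1..1}. \<bar>poly p x\<bar> \<le> B" by (auto simp: bounded_iff)
  then obtain B where B: "\<And>x. x \<in> {-1..1} \<Longrightarrow> \<bar>poly p x\<bar> \<le> B" by blast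
  have [measurable]: "poly p \<in> borel_measurable borel"
    by (intro borel_measurable_continuous_onI continuous_intros)
  show ?thesis
  proof (rule Bochner_Integration.integrable_bound[OF integrable_mult_right[OF I, of B]])
    show "AE x in lborel. norm (indicator {-1<..<1} x * (poly p x * ((1 - x) powr \<gamma> * (1 + x) powr \<delta>)))
      \<le> norm (B * ((2 powr \<delta> * 2 powr \<gamma>) * (indicator {-1..1} x * (((1 + x) / 2) powr \<delta> * ((1 - x) / 2) powr \<gamma>))))"
    proof (rule AE_I2)
      fix x :: real
      show "norm (indicator {-1<..<1} x * (poly p x * ((1 - x) powr \<gamma> * (1 + x) powr \<delta>)))
        \<le> norm (B * ((2 powr \<delta> * 2 powr \<gamma>) * (indicator {-1..1} x * (((1 + x) / 2) powr \<delta> * ((1 - x) / 2) powr \<gamma>))))"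
      proof (cases "x \<in> {-1<..<1}")
        case True
        then have "\<bar>poly p x\<bar> \<le> \<bar>B\<bar>" using B[of x] by auto
        then have "\<bar>poly p x\<bar> * ((1 - x) powr \<gamma> * (1 + x) powr \<delta>) \<le> \<bar>B\<bar> * ((1 - x) powr \<gamma> * (1 + x) powr \<delta>)"
          by (intro mult_right_mono) auto
        then show ?thesis using True by (simp add: abs_mult powr_divide)
      qed simp
    qed
  qed measurable
qed

lemma jacobi_functional_eq:
  "jacobi_functional \<gamma> \<delta> p = (\<integral>x. indicator {-1<..<1} x * (poly p x * ((1 - x) powr \<gamma> * (1 + x) powr \<delta>)) \<partial>lborel)"
  unfolding jacobi_functional_def
  by (subst interval_lebesgue_integral_le_eq, simp add: one_ereal_def) (simp_all add: einterval_minus_one_one set_lebesgue_integral_def)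

text \<open>A nonnegative function with zero integral vanishes almost everywhere. A nonzero
  polynomial has finitely many roots, so the whole interval would be a null set.\<close>

lemma jacobi_functional_nonneg_zero:
  assumes "\<gamma> > -1" "\<delta> > -1" "\<And>x. -1 < x \<Longrightarrow> x < 1 \<Longrightarrow> 0 \<le> poly p x" "jacobi_functional \<gamma> \<delta> p = 0"
  shows "p = 0"
proof (rule ccontr)
  assume p: "p \<noteq> 0"
  let ?f = "\<lambda>x. indicator {-1<..<1} x * (poly p x * ((1 - x) powr \<gamma> * (1 + x) powr \<delta>))"
  have "AE x in lborel. ?f x = 0"
    using assms integral_nonneg_eq_0_iff_AE[OF jacobi_weight_function_integrable[OF assms(1,2), of p]]
    by (auto simp: jacobi_functional_eq indicator_def)
  moreover have "AE x in lborel. x \<notin> {x. poly p x = 0}"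
    using poly_roots_finite[OF p] by (intro AE_not_in finite_imp_null_set_lborel)
  ultimately have "AE x in lborel. x \<notin> {-1<..<1::real}"
    by eventually_elim (auto simp: indicator_def)
  then have "emeasure lborel {-1<..<1::real} = 0"
    by (subst (asm) AE_iff_measurable[where N = "{-1<..<1}"]) auto
  then show False by simp
qed

lemma jacobi_functional_add:
  assumes "\<gamma> > -1" "\<delta> > -1"
  shows "jacobi_functional \<gamma> \<delta> (p + q) = jacobi_functional \<gamma> \<delta> p + jacobi_functional \<gamma> \<delta> q"
proof -
  note I = jacobi_weight_function_integrable[OF assms]
  show ?thesis
    unfolding jacobi_functional_eq Bochner_Integration.integral_add[OF I I, symmetric]
    by (intro Bochner_Integration.integral_cong) (simp_all add: algebra_simps)
qed

lemma jacobi_functional_smult: "jacobi_functional \<gamma> \<delta> (smult c p) = c * jacobi_functional \<gamma> \<delta> p"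
  unfolding jacobi_functional_def by (simp add: mult.assoc)

lemma jacobi_functional_diff:
  assumes "\<gamma> > -1" "\<delta> > -1"
  shows "jacobi_functional \<gamma> \<delta> (p - q) = jacobi_functional \<gamma> \<delta> p - jacobi_functional \<gamma> \<delta> q"
  using jacobi_functional_add[OF assms, of p "- q"] jacobi_functional_smult[of \<gamma> \<delta> "-1" q] by simp

lemma jacobi_family_spec_iff:
  "jacobi_family_spec \<gamma> \<delta> P \<longleftrightarrow>
     (\<forall>n. degree (P n) = n \<and> lead_coeff (P n) = pochhammer (real n + \<gamma> + \<delta> + 1) n / (2 ^ n * fact n)) \<and>
     (\<forall>n m. n \<noteq> m \<longrightarrow> jacobi_functional \<gamma> \<delta> (P n * P m) = 0)"
  unfolding jacobi_family_spec_def jacobi_functional_def by (simp add: mult.assoc)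

section \<open>The Jacobi differential operator and its eigenpolynomials\<close>

definition jacobi_operator :: "real \<Rightarrow> real \<Rightarrow> real poly \<Rightarrow> real poly" where
  "jacobi_operator \<gamma> \<delta> p = [:1, 0, -1:] * pderiv (pderiv p) + [:\<delta> - \<gamma>, - (\<gamma> + \<delta> + 2):] * pderiv p"

text \<open>Lagrange's identity: the weight times \<open>r\<close> is the derivative of
  \<open>F\<close>, which is the Wronskian \<open>W\<close> times the weight with both exponents
  raised by one. These raised exponents are positive, so \<open>F\<close> tends to 0 at both
  endpoints.\<close>

lemma jacobi_operator_symmetric:
  assumes "\<gamma> > -1" "\<delta> > -1"
  shows "jacobi_functional \<gamma> \<delta> (jacobi_operator \<gamma> \<delta> p * q) = jacobi_functional \<gamma> \<delta> (p * jacobi_operator \<gamma> \<delta> q)"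
proof -
  define W where "W = pderiv p * q - p * pderiv q"
  define F where "F x = (1 - x) powr (\<gamma> + 1) * (1 + x) powr (\<delta> + 1) * poly W x" for x
  define r where "r = jacobi_operator \<gamma> \<delta> p * q - p * jacobi_operator \<gamma> \<delta> q"
  define f where "f x = poly r x * ((1 - x) powr \<gamma> * (1 + x) powr \<delta>)" for x
  have r: "r = [:1, 0, -1:] * pderiv W + [:\<delta> - \<gamma>, - (\<gamma> + \<delta> + 2):] * W"
  proof -
    have "(A * p2 + B * p1) * q - p * (A * q2 + B * q1) = A * ((p2 * q + p1 * q1) - (p1 * q1 + p * q2)) + B * (p1 * q - p * q1)"
      for A B p1 p2 q1 q2 :: "real poly"
      by (simp add: algebra_simps)
    then show ?thesis by (simp only: r_def W_def jacobi_operator_def pderiv_diff pderiv_mult) (simp only: ac_simps)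
  qed
  have "(LBINT x=-1..1. f x) = 0 - 0"
  proof (rule interval_integral_FTC_integrable)
    show "(-1::ereal) < 1" by (simp add: one_ereal_def)
    show "set_integrable lborel (einterval (-1) 1) f"
      using jacobi_weight_function_integrable[OF assms, of r]
      by (simp add: set_integrable_def einterval_minus_one_one f_def)
    have e: "(-1::ereal) = ereal (-1)" "(1::ereal) = ereal 1" by (simp_all add: one_ereal_def)
    have lim1: "(F \<longlongrightarrow> (1 - (-1)) powr (\<gamma> + 1) * (1 + (-1)) powr (\<delta> + 1) * poly W (-1)) (at_right (-1))"
      unfolding F_def using assms
      by (intro tendsto_intros tendsto_powr' poly_isCont[THEN isContD, THEN tendsto_within_subset] conjI disjI2)
         (auto intro: eventually_mono[OF eventually_at_right_real[of "-1" 1]])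
    show "((F \<circ> real_of_ereal) \<longlongrightarrow> 0) (at_right (-1))"
      unfolding e(1) using lim1 assms by (subst ereal_tendsto_simps1) simp_all
    have lim2: "(F \<longlongrightarrow> (1 - 1) powr (\<gamma> + 1) * (1 + 1) powr (\<delta> + 1) * poly W 1) (at_left 1)"
      unfolding F_def using assms
      by (intro tendsto_intros tendsto_powr' poly_isCont[THEN isContD, THEN tendsto_within_subset] conjI disjI2)
         (auto intro: eventually_mono[OF eventually_at_left_real[of "-1" 1]])
    show "((F \<circ> real_of_ereal) \<longlongrightarrow> 0) (at_left 1)"
      unfolding e(2) ereal_tendsto_simps using lim2 assms by simp
    fix x :: real
    assume "-1 < ereal x" "ereal x < 1"
    then have x: "-1 < x" "x < 1" by (simp_all add: one_ereal_def)
    show "isCont f x" unfolding f_def using x by (intro continuous_intros) auto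
    have "(F has_real_derivative
        (- (\<gamma> + 1) * (1 - x) powr \<gamma> * (1 + x) powr (\<delta> + 1) + (1 - x) powr (\<gamma> + 1) * ((\<delta> + 1) * (1 + x) powr \<delta>)) * poly W x
        + (1 - x) powr (\<gamma> + 1) * (1 + x) powr (\<delta> + 1) * poly (pderiv W) x) (at x)"
      unfolding F_def using x by (auto intro!: derivative_eq_intros poly_DERIV simp: algebra_simps)
    also have "(- (\<gamma> + 1) * (1 - x) powr \<gamma> * (1 + x) powr (\<delta> + 1) + (1 - x) powr (\<gamma> + 1) * ((\<delta> + 1) * (1 + x) powr \<delta>)) * poly W x
        + (1 - x) powr (\<gamma> + 1) * (1 + x) powr (\<delta> + 1) * poly (pderiv W) x = f x"
      using x by (simp add: f_def r powr_add) (simp add: algebra_simps)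
    finally show "(F has_vector_derivative f x) (at x)"
      by (simp add: has_real_derivative_iff_has_vector_derivative)
  qed
  then have "jacobi_functional \<gamma> \<delta> r = 0" by (simp add: jacobi_functional_def f_def)
  then show ?thesis unfolding r_def jacobi_functional_diff[OF assms] by simp
qed

lemma jacobi_operator_add: "jacobi_operator \<gamma> \<delta> (p + q) = jacobi_operator \<gamma> \<delta> p + jacobi_operator \<gamma> \<delta> q"
  by (simp only: jacobi_operator_def pderiv_add distrib_left distrib_right ac_simps)

lemma jacobi_operator_smult: "jacobi_operator \<gamma> \<delta> (smult c p) = smult c (jacobi_operator \<gamma> \<delta> p)"
  by (simp add: jacobi_operator_def pderiv_smult smult_add_right)

lemma jacobi_operator_sum: "jacobi_operator \<gamma> \<delta> (\<Sum>k\<in>A. f k) = (\<Sum>k\<in>A. jacobi_operator \<gamma> \<delta> (f k))"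
proof (induction A rule: infinite_finite_induct)
  case (insert a A) then show ?case by (simp add: jacobi_operator_add)
qed (simp_all add: jacobi_operator_def)

text \<open>Sign convention: the operator has eigenvalue
  \<open>- jacobi_eigenvalue \<gamma> \<delta> k\<close> in degree \<open>k\<close>.\<close>

definition jacobi_eigenvalue :: "real \<Rightarrow> real \<Rightarrow> nat \<Rightarrow> real" where
  "jacobi_eigenvalue \<gamma> \<delta> k = real k * (real k + \<gamma> + \<delta> + 1)"

text \<open>The difference factors, and the second factor is positive because k is at least 1 and
  \<gamma> + \<delta> > -2. This separates the eigenvalues, which yields orthogonality.\<close>

lemma jacobi_eigenvalue_strict_mono:
  assumes "\<gamma> > -1" "\<delta> > -1" "j < k"
  shows "jacobi_eigenvalue \<gamma> \<delta> j < jacobi_eigenvalue \<gamma> \<delta> k"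
proof -
  have "jacobi_eigenvalue \<gamma> \<delta> k - jacobi_eigenvalue \<gamma> \<delta> j = (real k - real j) * (real k + real j + \<gamma> + \<delta> + 1)"
    by (simp add: jacobi_eigenvalue_def algebra_simps)
  moreover have "real k + real j + \<gamma> + \<delta> + 1 > 0" 
    using assms by (cases k) auto
  ultimately show ?thesis using assms by (smt (verit) mult_pos_pos of_nat_less_iff)
qed

text \<open>In the basis of powers of 1 - x the operator is bidiagonal, so the coefficients of an
  eigenpolynomial obey a one-step recursion.\<close>

lemma jacobi_operator_power:
  "jacobi_operator \<gamma> \<delta> ([:1, -1:] ^ Suc k) =
     smult (2 * real (Suc k) * (real (Suc k) + \<gamma>)) ([:1, -1:] ^ k) - smult (jacobi_eigenvalue \<gamma> \<delta> (Suc k)) ([:1, -1:] ^ Suc k)"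
proof -
  have "poly (jacobi_operator \<gamma> \<delta> ([:1, -1:] ^ Suc k)) x = 
     poly (smult (2 * real (Suc k) * (real (Suc k) + \<gamma>)) ([:1, -1:] ^ k) - smult (jacobi_eigenvalue \<gamma> \<delta> (Suc k)) ([:1, -1:] ^ Suc k)) x" for x
  proof (cases k)
    case 0
    then show ?thesis
      by (simp add: jacobi_operator_def jacobi_eigenvalue_def pderiv_pCons algebra_simps)
  next
    case (Suc m)
    have d1: "pderiv ([:1, -1:] ^ Suc k) = smult (- real (Suc k)) ([:1, -1:] ^ k :: real poly)" for k
      by (simp only: pderiv_power_Suc) (simp add: pderiv_pCons)
    show ?thesis unfolding jacobi_operator_def d1 pderiv_smult Suc
      by (simp add: jacobi_eigenvalue_def algebra_simps)
  qed
  then show ?thesis by (intro poly_eq_poly_eq_iff[THEN iffD1] ext)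
qed

text \<open>The solution of that recursion with value 1 at k = 0: the coefficients of the
  terminating hypergeometric series in (1 - x) / 2.\<close>

definition jacobi_eigencoeff :: "real \<Rightarrow> real \<Rightarrow> nat \<Rightarrow> nat \<Rightarrow> real" where
  "jacobi_eigencoeff \<gamma> \<delta> n k = (\<Prod>j<k. (jacobi_eigenvalue \<gamma> \<delta> j - jacobi_eigenvalue \<gamma> \<delta> n) /
     (2 * real (Suc j) * (real (Suc j) + \<gamma>)))"

definition jacobi_eigenpoly :: "real \<Rightarrow> real \<Rightarrow> nat \<Rightarrow> real poly" where
  "jacobi_eigenpoly \<gamma> \<delta> n = (\<Sum>k\<le>n. smult (jacobi_eigencoeff \<gamma> \<delta> n k) ([:1, -1:] ^ k))"

lemma jacobi_operator_eigenpoly: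
  assumes "\<gamma> > -1"
  shows "jacobi_operator \<gamma> \<delta> (jacobi_eigenpoly \<gamma> \<delta> n) = smult (- jacobi_eigenvalue \<gamma> \<delta> n) (jacobi_eigenpoly \<gamma> \<delta> n)"
proof -
  let ?c = "jacobi_eigencoeff \<gamma> \<delta> n" and ?\<mu> = "jacobi_eigenvalue \<gamma> \<delta>" and ?t = "[:1, -1::real:]"
  have c: "2 * real (Suc k) * (real (Suc k) + \<gamma>) * ?c (Suc k) = (?\<mu> k - ?\<mu> n) * ?c k" for k
  proof -
    have "2 * real (Suc k) * (real (Suc k) + \<gamma>) \<noteq> 0" using assms by auto
    then show ?thesis by (simp add: jacobi_eigencoeff_def)
  qed
  have L0: "jacobi_operator \<gamma> \<delta> (?t ^ 0) = 0" by (simp add: jacobi_operator_def)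
  have \<mu>0: "?\<mu> 0 = 0" by (simp add: jacobi_eigenvalue_def)
  \<comment> \<open>Truncating at any \<open>m\<close> telescopes to the eigenvalue equation below
    degree \<open>m\<close> plus one boundary term. At m = n the boundary term carries the same
    eigenvalue.\<close>
  have "(\<Sum>k\<le>m. smult (?c k) (jacobi_operator \<gamma> \<delta> (?t ^ k)))
     = smult (- ?\<mu> n) (\<Sum>k<m. smult (?c k) (?t ^ k)) - smult (?\<mu> m * ?c m) (?t ^ m)" for m
  proof (induction m)
    case 0 then show ?case by (simp add: L0[simplified] \<mu>0)
  next
    case (Suc m)
    have "smult (?c (Suc m)) (jacobi_operator \<gamma> \<delta> (?t ^ Suc m))
      = smult (2 * real (Suc m) * (real (Suc m) + \<gamma>) * ?c (Suc m)) (?t ^ m) - smult (?\<mu> (Suc m) * ?c (Suc m)) (?t ^ Suc m)"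
      unfolding jacobi_operator_power by (simp add: smult_diff_right mult_ac del: power_Suc)
    then show ?case unfolding sum.atMost_Suc Suc sum.lessThan_Suc c
      by (simp add: smult_add_right smult_diff_left algebra_simps del: power_Suc)
  qed
  then show ?thesis
    unfolding jacobi_eigenpoly_def jacobi_operator_sum jacobi_operator_smult
    by (simp add: lessThan_Suc_atMost[symmetric] smult_add_right mult_ac)
qed

text \<open>Only the top power contributes in degree \<open>n\<close>, and its coefficient is a
  product of quotients whose numerators are differences of distinct eigenvalues.\<close>

lemma jacobi_eigenpoly_degree:
  assumes "\<gamma> > -1" "\<delta> > -1"
  shows "degree (jacobi_eigenpoly \<gamma> \<delta> n) = n" "lead_coeff (jacobi_eigenpoly \<gamma> \<delta> n) \<noteq> 0"
proof -
  let ?c = "jacobi_eigencoeff \<gamma> \<delta> n" and ?t = "[:1, -1::real:]"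
  have dt: "degree (?t ^ k) = k" for k by (simp add: degree_power_eq)
  have cn: "?c n \<noteq> 0"
    using jacobi_eigenvalue_strict_mono[OF assms, of _ n] assms
    by (fastforce simp: jacobi_eigencoeff_def)
  have "degree (jacobi_eigenpoly \<gamma> \<delta> n) \<le> n" unfolding jacobi_eigenpoly_def
    by (intro degree_sum_le) (auto intro!: order_trans[OF degree_smult_le] simp: dt)
  moreover have "coeff (jacobi_eigenpoly \<gamma> \<delta> n) n = ?c n * coeff (?t ^ n) n"
  proof -
    have "coeff (jacobi_eigenpoly \<gamma> \<delta> n) n = (\<Sum>k\<le>n. ?c k * coeff (?t ^ k) n)"
      by (simp add: jacobi_eigenpoly_def coeff_sum)
    also have "\<dots> = (\<Sum>k\<in>{n}. ?c k * coeff (?t ^ k) n)"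
      by (intro sum.mono_neutral_right) (auto simp: coeff_eq_0 dt)
    finally show ?thesis by simp
  qed
  moreover have "coeff (?t ^ n) n \<noteq> 0" using leading_coeff_0_iff[of "?t ^ n"] by (simp add: dt)
  ultimately have "coeff (jacobi_eigenpoly \<gamma> \<delta> n) n \<noteq> 0" using cn by simp
  moreover from this have "degree (jacobi_eigenpoly \<gamma> \<delta> n) = n"
    using \<open>degree (jacobi_eigenpoly \<gamma> \<delta> n) \<le> n\<close> by (intro antisym le_degree) auto
  ultimately show "degree (jacobi_eigenpoly \<gamma> \<delta> n) = n" "lead_coeff (jacobi_eigenpoly \<gamma> \<delta> n) \<noteq> 0" by auto
qed

section \<open>Existence and uniqueness of the orthogonal family\<close>

lemma jacobi_leading_coeff_pos:
  assumes "\<gamma> > -1" "\<delta> > -1"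
  shows "pochhammer (real n + \<gamma> + \<delta> + 1) n / (2 ^ n * fact n) > 0"
\<comment> \<open>For n = 0 the Pochhammer symbol is 1 whatever its base. For larger n the base is
  positive since \<gamma> + \<delta> > -2.\<close>
proof (cases n)
  case (Suc m)
  then have "real n + \<gamma> + \<delta> + 1 > 0" using assms by simp
  then show ?thesis by (intro divide_pos_pos pochhammer_pos) auto
qed simp

lemma jacobi_family_specD:
  assumes "jacobi_family_spec \<gamma> \<delta> P"
  shows "degree (P n) = n" "coeff (P n) n = pochhammer (real n + \<gamma> + \<delta> + 1) n / (2 ^ n * fact n)"
    "n \<noteq> m \<Longrightarrow> jacobi_functional \<gamma> \<delta> (P n * P m) = 0"
  using assms unfolding jacobi_family_spec_iff by metis+

text \<open>Eigenpolynomials of a symmetric operator for distinct eigenvalues are orthogonal;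
  rescaling them gives the prescribed leading coefficients.\<close>

lemma ex_jacobi_family:
  assumes "\<gamma> > -1" "\<delta> > -1"
  shows "\<exists>P. jacobi_family_spec \<gamma> \<delta> P \<and> (\<forall>n. jacobi_operator \<gamma> \<delta> (P n) = smult (- jacobi_eigenvalue \<gamma> \<delta> n) (P n))"
proof -
  define l where "l n = pochhammer (real n + \<gamma> + \<delta> + 1) n / (2 ^ n * fact n)" for n
  have l: "l n > 0" for n unfolding l_def by (rule jacobi_leading_coeff_pos[OF assms])
  let ?e = "jacobi_eigenpoly \<gamma> \<delta>"
  define P where "P n = smult (l n / lead_coeff (?e n)) (?e n)" for n
  note e = jacobi_eigenpoly_degree[OF assms]
  have eig: "jacobi_operator \<gamma> \<delta> (P n) = smult (- jacobi_eigenvalue \<gamma> \<delta> n) (P n)" for n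
    unfolding P_def jacobi_operator_smult jacobi_operator_eigenpoly[OF assms(1)] by (simp add: mult.commute)
  have "jacobi_family_spec \<gamma> \<delta> P"
    unfolding jacobi_family_spec_iff
  proof (intro conjI allI impI)
    fix n
    show "degree (P n) = n" using e l[of n] by (simp add: P_def)
    show "lead_coeff (P n) = pochhammer (real n + \<gamma> + \<delta> + 1) n / (2 ^ n * fact n)"
      using e l[of n] by (simp add: P_def l_def[symmetric])
  next
    fix n m :: nat assume "n \<noteq> m"
    then have ne: "jacobi_eigenvalue \<gamma> \<delta> n \<noteq> jacobi_eigenvalue \<gamma> \<delta> m"
      using jacobi_eigenvalue_strict_mono[OF assms, of n m] jacobi_eigenvalue_strict_mono[OF assms, of m n] by linarith
    have "- jacobi_eigenvalue \<gamma> \<delta> n * jacobi_functional \<gamma> \<delta> (P n * P m) = - jacobi_eigenvalue \<gamma> \<delta> m * jacobi_functional \<gamma> \<delta> (P n * P m)"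
      using jacobi_operator_symmetric[OF assms, of "P n" "P m"]
      unfolding eig mult_smult_left mult_smult_right jacobi_functional_smult .
    then show "jacobi_functional \<gamma> \<delta> (P n * P m) = 0" using ne by simp
  qed
  then show ?thesis using eig by blast
qed

text \<open>Subtracting the multiple of \<open>P d\<close> that cancels the leading term of
  \<open>q\<close> lowers the degree, and \<open>P d\<close> itself is orthogonal to
  \<open>P n\<close>.\<close>

lemma jacobi_family_orthogonal:
  assumes gd: "\<gamma> > -1" "\<delta> > -1" and P: "jacobi_family_spec \<gamma> \<delta> P"
  shows "degree q < n \<Longrightarrow> jacobi_functional \<gamma> \<delta> (q * P n) = 0"
proof (induction "degree q" arbitrary: q rule: less_induct)
  case less
  define d where "d = degree q"
  have P': "degree (P k) = k" "lead_coeff (P k) > 0" for k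
    using jacobi_leading_coeff_pos[OF gd, of k] by (simp_all add: jacobi_family_specD[OF P])
  define c where "c = lead_coeff q / lead_coeff (P d)"
  define r where "r = q - smult c (P d)"
  have "coeff r d = 0" using P'[of d] by (simp add: r_def c_def d_def)
  moreover have "degree r \<le> d" unfolding r_def using P'(1)[of d]
    by (intro degree_diff_le) (auto simp: d_def intro: order_trans[OF degree_smult_le])
  ultimately have "r = 0 \<or> degree r < d"
    by (metis eq_zero_or_degree_less)
  then have r: "jacobi_functional \<gamma> \<delta> (r * P n) = 0"
  proof
    assume "r = 0" then show ?thesis by (simp add: jacobi_functional_def)
  next
    assume "degree r < d" then show ?thesis using less by (simp add: d_def)
  qed
  have "jacobi_functional \<gamma> \<delta> (P d * P n) = 0"
    using jacobi_family_specD(3)[OF P] less.prems by (simp add: d_def)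
  moreover have "q * P n = r * P n + smult c (P d * P n)" by (simp add: r_def algebra_simps)
  ultimately show ?case using r by (simp add: jacobi_functional_add[OF gd] jacobi_functional_smult)
qed

text \<open>The leading coefficients agree, so the difference \<open>D\<close> has lower degree and
  is orthogonal to both candidates, hence to itself.\<close>

lemma jacobi_family_unique:
  assumes gd: "\<gamma> > -1" "\<delta> > -1" and P: "jacobi_family_spec \<gamma> \<delta> P" and Q: "jacobi_family_spec \<gamma> \<delta> Q"
  shows "P = Q"
proof
  fix n
  have d: "degree (P n) = n" "degree (Q n) = n" "coeff (P n) n = coeff (Q n) n"
    by (simp_all add: jacobi_family_specD[OF P] jacobi_family_specD[OF Q])
  define D where "D = P n - Q n"
  have "coeff D n = 0" "degree D \<le> n" using d by (auto simp: D_def intro: degree_diff_le)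
  then have "D = 0 \<or> degree D < n" by (metis eq_zero_or_degree_less)
  then have "D = 0"
  proof
    assume "degree D < n"
    then have "jacobi_functional \<gamma> \<delta> (D * P n) = 0" "jacobi_functional \<gamma> \<delta> (D * Q n) = 0"
      using jacobi_family_orthogonal[OF gd] P Q by auto
    moreover have "D * D = D * P n - D * Q n" by (simp add: D_def algebra_simps)
    ultimately have "jacobi_functional \<gamma> \<delta> (D * D) = 0" by (simp add: jacobi_functional_diff[OF gd])
    then have "D * D = 0" by (rule jacobi_functional_nonneg_zero[OF gd, rotated]) simp
    then show ?thesis by simp
  qed simp
  then show "P n = Q n" by (simp add: D_def)
qed

text \<open>The specification has exactly one solution, so the definite description denotes the
  eigenpolynomial family and inherits its properties.\<close>

lemma jacobiP_properties:
  assumes gd: "\<gamma> > -1" "\<delta> > -1"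
  shows "degree (jacobiP n \<gamma> \<delta>) = n" "jacobiP n \<gamma> \<delta> \<noteq> 0"
    "degree q < n \<Longrightarrow> jacobi_functional \<gamma> \<delta> (q * jacobiP n \<gamma> \<delta>) = 0"
    "jacobi_operator \<gamma> \<delta> (jacobiP n \<gamma> \<delta>) = smult (- jacobi_eigenvalue \<gamma> \<delta> n) (jacobiP n \<gamma> \<delta>)"
proof -
  obtain P where P: "jacobi_family_spec \<gamma> \<delta> P"
    "\<And>n. jacobi_operator \<gamma> \<delta> (P n) = smult (- jacobi_eigenvalue \<gamma> \<delta> n) (P n)"
    using ex_jacobi_family[OF gd] by blast
  have "(THE P. jacobi_family_spec \<gamma> \<delta> P) = P"
    using P(1) jacobi_family_unique[OF gd] by (intro the_equality) auto
  then have eq: "jacobiP n \<gamma> \<delta> = P n" by (simp add: jacobiP_def)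
  show "degree (jacobiP n \<gamma> \<delta>) = n" unfolding eq by (rule jacobi_family_specD(1)[OF P(1)])
  have "lead_coeff (P n) > 0" using jacobi_leading_coeff_pos[OF gd, of n] by (simp add: jacobi_family_specD[OF P(1)])
  then show "jacobiP n \<gamma> \<delta> \<noteq> 0" unfolding eq by auto
  show "degree q < n \<Longrightarrow> jacobi_functional \<gamma> \<delta> (q * jacobiP n \<gamma> \<delta>) = 0"
    unfolding eq by (rule jacobi_family_orthogonal[OF gd P(1)])
  show "jacobi_operator \<gamma> \<delta> (jacobiP n \<gamma> \<delta>) = smult (- jacobi_eigenvalue \<gamma> \<delta> n) (jacobiP n \<gamma> \<delta>)"
    unfolding eq by (rule P(2))
qed

section \<open>The zeros and their electrostatic equilibrium\<close>

text \<open>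
  \<open>R\<close> consists of the roots of odd multiplicity; peeling off one root at a time avoids multiplicities.
\<close>

lemma poly_constant_sign_multiplier:
  fixes p :: "real poly"
  assumes "p \<noteq> 0" "l < u"
  shows "\<exists>R. finite R \<and> R \<subseteq> {x. l < x \<and> x < u \<and> poly p x = 0} \<and>
    ((\<forall>x. l < x \<and> x < u \<longrightarrow> 0 \<le> poly (p * (\<Prod>r\<in>R. [:-r, 1:])) x) \<or>
     (\<forall>x. l < x \<and> x < u \<longrightarrow> poly (p * (\<Prod>r\<in>R. [:-r, 1:])) x \<le> 0))"
  using assms(1)
proof (induction "degree p" arbitrary: p rule: less_induct)
  case less
  show ?case
  proof (cases "\<exists>r. l < r \<and> r < u \<and> poly p r = 0")
    case False
    have "(\<forall>x. l < x \<and> x < u \<longrightarrow> 0 \<le> poly p x) \<or> (\<forall>x. l < x \<and> x < u \<longrightarrow> poly p x \<le> 0)"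
    proof (rule ccontr)
      assume "\<not> ?thesis"
      then obtain x y where xy: "l < x" "x < u" "poly p x < 0" "l < y" "y < u" "poly p y > 0" by (auto simp: not_le)
      then have "x \<noteq> y" by auto
      then consider "x < y" | "y < x" by linarith
      then show False
      proof cases
        case 1 then show ?thesis using poly_IVT_pos[of x y p] xy False by force
      next
        case 2 then show ?thesis using poly_IVT_neg[of y x p] xy False by force
      qed
    qed
    then show ?thesis by (intro exI[of _ "{}"]) simp
  next
    case True
    then obtain r where r: "l < r" "r < u" "poly p r = 0" by blast
    then obtain p1 where p1: "p = [:-r, 1:] * p1" by (auto simp: poly_eq_0_iff_dvd elim: dvdE)
    have p10: "p1 \<noteq> 0" using less.prems p1 by auto
    then have "degree p1 < degree p" unfolding p1 by (subst degree_mult_eq) auto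
    from less.hyps[OF this p10] obtain R where R: "finite R" "R \<subseteq> {x. l < x \<and> x < u \<and> poly p1 x = 0}"
      "(\<forall>x. l < x \<and> x < u \<longrightarrow> 0 \<le> poly (p1 * (\<Prod>r\<in>R. [:-r, 1:])) x) \<or>
       (\<forall>x. l < x \<and> x < u \<longrightarrow> poly (p1 * (\<Prod>r\<in>R. [:-r, 1:])) x \<le> 0)" by blast
    show ?thesis
    proof (cases "r \<in> R")
      case True
      have "(\<Prod>r\<in>R. [:-r, 1:]) = [:-r, 1:] * (\<Prod>r\<in>R - {r}. [:-r, 1:])"
        using prod.remove[OF R(1) True] .
      then have "p * (\<Prod>r\<in>R - {r}. [:-r, 1:]) = p1 * (\<Prod>r\<in>R. [:-r, 1:])"
        unfolding p1 by (simp only: mult_ac)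
      then show ?thesis using R by (intro exI[of _ "R - {r}"]) (auto simp: p1)
    next
      case False
      have "p * (\<Prod>r\<in>insert r R. [:-r, 1:]) = [:-r, 1:]\<^sup>2 * (p1 * (\<Prod>r\<in>R. [:-r, 1:]))"
        unfolding p1 prod.insert[OF R(1) False] power2_eq_square by (simp only: mult_ac)
      then have "poly (p * (\<Prod>r\<in>insert r R. [:-r, 1:])) x = (x - r)\<^sup>2 * poly (p1 * (\<Prod>r\<in>R. [:-r, 1:])) x" for x
        by (simp only: poly_mult poly_power) simp
      then show ?thesis using R r
        by (intro exI[of _ "insert r R"])
           (auto simp: p1 zero_le_mult_iff mult_le_0_iff simp del: poly_mult)
    qed
  qed
qed

text \<open>With fewer than \<open>n\<close> roots of odd multiplicity inside the interval, the
  multiplier \<open>q\<close> would have degree below \<open>n\<close>. Then \<open>?p * q\<close>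
  would have constant sign and zero integral, hence vanish.\<close>

lemma jacobiP_roots:
  assumes gd: "\<gamma> > -1" "\<delta> > -1"
  shows "card {x. poly (jacobiP n \<gamma> \<delta>) x = 0} = n" "{x. poly (jacobiP n \<gamma> \<delta>) x = 0} \<subseteq> {-1<..<1}"
proof -
  let ?p = "jacobiP n \<gamma> \<delta>"
  note J = jacobiP_properties[OF gd, where n = n]
  obtain R where R: "finite R" "R \<subseteq> {x. -1 < x \<and> x < 1 \<and> poly ?p x = 0}"
      "(\<forall>x. -1 < x \<and> x < 1 \<longrightarrow> 0 \<le> poly (?p * (\<Prod>r\<in>R. [:-r, 1:])) x) \<or>
       (\<forall>x. -1 < x \<and> x < 1 \<longrightarrow> poly (?p * (\<Prod>r\<in>R. [:-r, 1:])) x \<le> 0)"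
    using poly_constant_sign_multiplier[OF J(2), of "-1" 1] by auto
  define q where "q = (\<Prod>r\<in>R. [:-r, 1:])"
  have q: "degree q = card R" "q \<noteq> 0" using R(1) by (simp_all add: q_def degree_prod_eq_sum_degree)
  have "card R \<ge> n"
  proof (rule ccontr)
    assume "\<not> card R \<ge> n"
    then have z: "jacobi_functional \<gamma> \<delta> (?p * q) = 0" using J(3)[of q] q by (simp add: mult.commute)
    from R(3) have "?p * q = 0"
    proof
      assume "\<forall>x. -1 < x \<and> x < 1 \<longrightarrow> 0 \<le> poly (?p * (\<Prod>r\<in>R. [:-r, 1:])) x"
      then show ?thesis using z by (intro jacobi_functional_nonneg_zero[OF gd]) (auto simp: q_def)
    next
      assume *: "\<forall>x. -1 < x \<and> x < 1 \<longrightarrow> poly (?p * (\<Prod>r\<in>R. [:-r, 1:])) x \<le> 0"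
      have "smult (-1) (?p * q) = 0"
        using z * by (intro jacobi_functional_nonneg_zero[OF gd]) (auto simp only: jacobi_functional_smult q_def poly_smult)
      then show ?thesis by simp
    qed
    then show False using J(2) q by simp
  qed
  moreover have "R \<subseteq> {x. poly ?p x = 0}" using R(2) by auto
  moreover have "card {x. poly ?p x = 0} \<le> n" using card_poly_roots_bound[OF J(2)] J(1) by simp
  moreover have fin: "finite {x. poly ?p x = 0}" using poly_roots_finite[OF J(2)] .
  ultimately have "card R = n" "card R = card {x. poly ?p x = 0}" "R \<subseteq> {x. poly ?p x = 0}"
    using card_mono[OF fin, of R] by auto
  moreover from this have "R = {x. poly ?p x = 0}" using card_subset_eq[OF fin] by blast
  ultimately have eq: "{x. poly ?p x = 0} = R" and "card R = n" by simp_all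
  then show "card {x. poly ?p x = 0} = n" by simp
  show "{x. poly ?p x = 0} \<subseteq> {-1<..<1}" unfolding eq using R(2) by auto
qed

text \<open>Writing p = c (x - r) g gives p'(r) = c g(r) and p''(r) = 2 c g'(r), where g'(r) / g(r)
  is the sum of reciprocals. The differential equation at \<open>r\<close>, where the term with p
  drops out, relates these two derivatives.\<close>

lemma jacobiP_stieltjes:
  assumes gd: "\<gamma> > -1" "\<delta> > -1" and r: "poly (jacobiP n \<gamma> \<delta>) r = 0"
  shows "(\<Sum>s\<in>{x. poly (jacobiP n \<gamma> \<delta>) x = 0} - {r}. 1 / (r - s)) = ((\<gamma> + 1) / (1 - r) - (\<delta> + 1) / (1 + r)) / 2"
proof -
  let ?p = "jacobiP n \<gamma> \<delta>"
  define R where "R = {x. poly ?p x = 0}"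
  note J = jacobiP_properties[OF gd, where n = n]
  have R: "card R = n" "R \<subseteq> {-1<..<1}" "finite R" "r \<in> R"
    using jacobiP_roots[OF gd, of n] poly_roots_finite[OF J(2)] r by (auto simp: R_def)
  have r1: "-1 < r" "r < 1" using R by auto
  define c where "c = lead_coeff ?p"
  have c: "c \<noteq> 0" using J(2) by (simp add: c_def)
  define g where "g = (\<Prod>s\<in>R - {r}. [:-s, 1:])"
  have prodR: "(\<Prod>s\<in>R. [:-s, 1:]) = [:-r, 1:] * g" unfolding g_def by (rule prod.remove[OF R(3,4)])
  have "?p = smult c (\<Prod>s\<in>R. [:-s, 1:])"
  proof (rule poly_eqI_degree_lead_coeff[where n = n and A = R])
    have d: "degree (\<Prod>s\<in>R. [:-s, 1:]) = n" using R by (simp add: degree_prod_eq_sum_degree)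
    then show "degree (smult c (\<Prod>s\<in>R. [:-s, 1:])) \<le> n" by simp
    have "lead_coeff (\<Prod>s\<in>R. [:-s, 1:]) = 1" by (simp add: lead_coeff_prod)
    then show "coeff ?p n = coeff (smult c (\<Prod>s\<in>R. [:-s, 1:])) n" using d J(1) by (simp add: c_def)
    fix z assume z: "z \<in> R"
    then show "poly ?p z = poly (smult c (\<Prod>s\<in>R. [:-s, 1:])) z"
      using R(3) by (auto simp: R_def poly_prod)
  qed (use R J(1) in auto)
  then have p: "?p = smult c ([:-r, 1:] * g)" by (simp only: prodR)
  have gr: "poly g r = (\<Prod>s\<in>R - {r}. r - s)" by (simp add: g_def poly_prod)
  then have g0: "poly g r \<noteq> 0" using R(3) by auto
  have "poly (pderiv g) r = (\<Sum>s\<in>R - {r}. \<Prod>t\<in>R - {r} - {s}. r - t)"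
    by (simp add: g_def pderiv_prod poly_sum poly_prod pderiv_pCons)
  also have "\<dots> = (\<Sum>s\<in>R - {r}. poly g r * (1 / (r - s)))"
  proof (rule sum.cong[OF refl])
    fix s assume s: "s \<in> R - {r}"
    have "poly g r = (r - s) * (\<Prod>t\<in>R - {r} - {s}. r - t)"
      unfolding gr using R(3) s by (intro prod.remove) auto
    then show "(\<Prod>t\<in>R - {r} - {s}. r - t) = poly g r * (1 / (r - s))" using s by auto
  qed
  finally have g': "poly (pderiv g) r = poly g r * (\<Sum>s\<in>R - {r}. 1 / (r - s))" (is "_ = _ * ?S") by (simp add: sum_distrib_left)
  have d1: "poly (pderiv ?p) r = c * poly g r"
    unfolding p pderiv_smult pderiv_mult by (simp add: pderiv_pCons)
  have d2: "poly (pderiv (pderiv ?p)) r = c * (2 * poly (pderiv g) r)"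
    unfolding p pderiv_smult pderiv_mult pderiv_add by (simp add: pderiv_pCons)
  have "poly (jacobi_operator \<gamma> \<delta> ?p) r = 0" unfolding J(4) using r by simp
  then have "(1 - r * r) * (c * (2 * (poly g r * ?S))) + (\<delta> - \<gamma> - (\<gamma> + \<delta> + 2) * r) * (c * poly g r) = 0"
    unfolding jacobi_operator_def poly_add poly_mult d1 d2 g' by (simp add: algebra_simps)
  then have "c * poly g r * ((1 - r * r) * 2 * ?S + (\<delta> - \<gamma> - (\<gamma> + \<delta> + 2) * r)) = 0"
    by (simp add: algebra_simps)
  then have "(1 - r * r) * 2 * ?S + (\<delta> - \<gamma> - (\<gamma> + \<delta> + 2) * r) = 0"
    using c g0 by (simp only: mult_eq_0_iff simp_thms)
  then have E: "(1 - r) * (1 + r) * 2 * ?S = (\<gamma> + 1) * (1 + r) - (\<delta> + 1) * (1 - r)"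
    by (simp add: algebra_simps)
  have "?S = ((1 - r) * (1 + r) * 2 * ?S) / ((1 - r) * (1 + r) * 2)" using r1 by simp
  also have "\<dots> = ((\<gamma> + 1) / (1 - r) - (\<delta> + 1) / (1 + r)) / 2"
    unfolding E using r1 by (simp add: diff_divide_distrib)
  finally show ?thesis by (simp add: R_def)
qed

section \<open>Displacing particles away from the zeros\<close>

text \<open>Configurations ordered like their targets. On this set particle \<open>i\<close> can be
  compared with \<open>y i\<close> directly, without sorting.\<close>

definition chamber :: "nat \<Rightarrow> (nat \<Rightarrow> real) \<Rightarrow> (nat \<Rightarrow> real) set" where
  "chamber n y = {v. \<forall>i<n. \<forall>j<n. y i < y j \<longrightarrow> v i < v j}"

lemma sum_offdiagonal:
  fixes h :: "nat \<Rightarrow> nat \<Rightarrow> real"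
  shows "(\<Sum>i<n. \<Sum>j\<in>{i<..<n}. h i j + h j i) = (\<Sum>i<n. \<Sum>j\<in>{..<n} - {i}. h i j)"
proof -
  have "(\<Sum>i<n. \<Sum>j\<in>{i<..<n}. h j i) = (\<Sum>j<n. \<Sum>i\<in>{..<j}. h j i)"
    by (subst sum.Sigma, simp, simp, subst sum.Sigma, simp, simp)
       (rule sum.reindex_bij_witness[of _ "\<lambda>(a,b). (b,a)" "\<lambda>(a,b). (b,a)"], auto)
  moreover have "(\<Sum>j\<in>{..<n} - {i}. h i j) = (\<Sum>j\<in>{i<..<n}. h i j) + (\<Sum>j\<in>{..<i}. h i j)" if "i < n" for i
  proof -
    have "{..<n} - {i} = {i<..<n} \<union> {..<i}" using that by auto
    show ?thesis unfolding \<open>{..<n} - {i} = _\<close> by (rule sum.union_disjoint) auto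
  qed
  ultimately show ?thesis by (simp add: sum.distrib)
qed

text \<open>
  The force on a particle whose target has distance \<open>\<rho>\<close> from the edge \<open>2\<close> and which sits \<open>\<delta>\<close> above
  its target. Here \<open>k\<close> stands for \<open>\<beta>\<close> times the number of particles left in place at the edge, whose
  targets are within \<open>c0\<close> of it.
\<close>

lemma force_bound:
  fixes a b k c c0 \<kappa> \<rho> \<delta> :: real
  assumes "a > -1" "b > -1" "k \<ge> 0" "a + k \<ge> 1" "c > 0" "0 \<le> c0" "2 * c0 \<le> c"
    and d: "\<delta> > c" "\<delta> < \<rho>" "\<rho> < 4"
    and cases: "(b \<ge> 32 * \<kappa> \<and> c\<^sup>2 * b \<ge> 32) \<or> (k = 0 \<and> c0 = 0 \<and> a \<ge> 32 * \<kappa> \<and> a * c \<ge> 8)"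
  shows "(a + 1) / \<rho> - (b + 1) / (4 - \<rho>) + k / (\<rho> - c0) - (a + k) / (\<rho> - \<delta>)
     + max b 0 / (4 - \<rho> + \<delta>) \<le> - (\<kappa> * \<delta>)"
proof -
  define r where "r = \<rho> - \<delta>"
  have r: "r > 0" "r < 4" using d assms by (auto simp: r_def)
  have pos: "\<rho> - c0 > 0" "\<rho> > 0" using d assms by auto
  \<comment> \<open>The lower edge yields a restoring force linear in \<delta>, because both
    distances to -2 are at most 4. For negative \<open>b\<close> only nonpositivity is
    claimed.\<close>
  have B: "max b 0 / (4 - \<rho> + \<delta>) - (b + 1) / (4 - \<rho>) \<le> - (max b 0 * \<delta> / 16)"
  proof (cases "b \<ge> 0")
    case True
    have p: "4 - \<rho> > 0" "4 - \<rho> + \<delta> > 0" "(4 - \<rho> + \<delta>) * (4 - \<rho>) \<le> 16"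
      using d assms r mult_mono[of "4 - \<rho> + \<delta>" 4 "4-\<rho>" 4] unfolding r_def by auto
    have "b / (4 - \<rho> + \<delta>) - (b + 1) / (4 - \<rho>) \<le> b / (4 - \<rho> + \<delta>) - b / (4 - \<rho>)"
      using p by (simp add: divide_right_mono)
    also have "\<dots> = - (b * \<delta> / ((4 - \<rho> + \<delta>) * (4 - \<rho>)))"
      using p by (simp add: field_simps)
    also have "\<dots> \<le> - (b * \<delta> / 16)"
      using p True d assms by (intro le_imp_neg_le divide_left_mono mult_nonneg_nonneg mult_pos_pos) auto
    finally show ?thesis using True by simp
  next
    case False
    then show ?thesis using assms by simp
  qed
  have Q: "(a + 1) / \<rho> + k / (\<rho> - c0) \<le> (a + 1 + k) / (\<rho> - c0)"
  proof -
    have "(a + 1) / \<rho> \<le> (a + 1) / (\<rho> - c0)"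
      using pos assms by (intro divide_left_mono) auto
    then show ?thesis by (simp add: add_divide_distrib)
  qed
  \<comment> \<open>The term \<open>r\<close> in the numerator is the trace of the mismatch between
    the exponents \<open>a + 1\<close> and \<open>a\<close>.\<close>
  have E: "(a + 1 + k) / (\<rho> - c0) - (a + k) / r = (r - (a + k) * (\<delta> - c0)) / (r * (\<rho> - c0))"
    using pos r by (simp add: r_def field_simps)
  from cases show ?thesis
  proof
    assume b: "b \<ge> 32 * \<kappa> \<and> c\<^sup>2 * b \<ge> 32"
    have b0: "b > 0"
    proof (rule ccontr)
      assume "\<not> b > 0"
      then have "c\<^sup>2 * b \<le> 0" by (intro mult_nonneg_nonpos) auto
      then show False using b by simp
    qed
    have dc: "\<delta> - c0 \<ge> \<delta> / 2" "\<delta> > 0" using assms by auto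
    \<comment> \<open>Close to the edge, \<open>a + k \<ge> 1\<close> makes the numerator
      nonpositive. Otherwise \<open>\<rho> - c0\<close>, which equals r + (\<delta> - c0), exceeds
      \<delta>, and 1 / \<delta> is at most b \<delta> / 32 because c^2 b is at least 32.\<close>
    have "(r - (a + k) * (\<delta> - c0)) / (r * (\<rho> - c0)) \<le> b * \<delta> / 32"
    proof (cases "r \<le> \<delta> - c0")
      case True
      moreover have "1 * (\<delta> - c0) \<le> (a + k) * (\<delta> - c0)"
        using assms(4) dc by (intro mult_right_mono) linarith+
      ultimately have "r \<le> (a + k) * (\<delta> - c0)" by simp
      then have "(r - (a + k) * (\<delta> - c0)) / (r * (\<rho> - c0)) \<le> 0" using r pos by (simp add: divide_nonpos_pos)
      also have "0 \<le> b * \<delta> / 32" using b0 dc by simp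
      finally show ?thesis .
    next
      case False
      have "(r - (a + k) * (\<delta> - c0)) / (r * (\<rho> - c0)) \<le> r / (r * (\<rho> - c0))"
        using assms dc r pos by (intro divide_right_mono) auto
      also have "\<dots> = 1 / (\<rho> - c0)" using r by simp
      also have "\<dots> \<le> 1 / \<delta>" using False dc r_def pos by (intro divide_left_mono) auto
      also have "\<dots> \<le> b * \<delta> / 32"
      proof -
        have "32 \<le> c\<^sup>2 * b" using b by simp
        also have "\<dots> \<le> \<delta>\<^sup>2 * b" using b0 d assms by (intro mult_right_mono power_mono) auto
        finally show ?thesis using dc by (simp add: field_simps power2_eq_square)
      qed
      finally show ?thesis .
    qed
    \<comment> \<open>One half of the force b \<delta> / 16 pays for the upper edge; the other half
      dominates \<kappa> \<delta>.\<close>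
    moreover have "\<kappa> * \<delta> \<le> b * \<delta> / 32" using b dc mult_right_mono[of "32*\<kappa>" b \<delta>] by simp
    moreover have "max b 0 = b" using b0 by simp
    moreover have arith: "x1 - x2 + x3 - x4 + x5 \<le> - kd"
      if "X \<le> bd / 32" "kd \<le> bd / 32" "x5 - x2 \<le> - (bd / 16)" "x1 + x3 \<le> x6" "x6 - x4 = X"
      for x1 x2 x3 x4 x5 x6 X kd bd :: real
      using that by linarith
    ultimately show ?thesis using B Q E unfolding r_def[symmetric] by (intro arith[where bd = "b * \<delta>"]) auto
  next
    assume h: "k = 0 \<and> c0 = 0 \<and> a \<ge> 32 * \<kappa> \<and> a * c \<ge> 8"
    have a0: "a \<ge> 1" using h assms by simp
    \<comment> \<open>Since r < 4 \<le> a \<delta> / 2, half of the repulsion from the upper edge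
      absorbs the mismatch term \<open>r\<close>, and the rest still dominates \<kappa>
      \<delta>.\<close>
    have "8 \<le> a * \<delta>" using h d a0 mult_left_mono[of c \<delta> a] by linarith
    then have "r - (a + k) * (\<delta> - c0) \<le> - (a * \<delta> / 2)" using h r by simp
    then have "(r - (a + k) * (\<delta> - c0)) / (r * (\<rho> - c0)) \<le> - (a * \<delta> / 2) / (r * (\<rho> - c0))"
      using r pos by (intro divide_right_mono) auto
    also have "\<dots> \<le> - (a * \<delta> / 2) / 16"
      using r pos d a0 h mult_mono[of r 4 \<rho> 4] assms
      by (intro divide_left_mono_neg) auto
    also have "\<dots> \<le> - (\<kappa> * \<delta>)" using h d assms mult_right_mono[of "32*\<kappa>" a \<delta>] by simp
    finally have "(r - (a + k) * (\<delta> - c0)) / (r * (\<rho> - c0)) \<le> - (\<kappa> * \<delta>)" .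
    moreover have "max b 0 * \<delta> / 16 \<ge> 0" using d assms by simp
    moreover have arith: "x1 - x2 + x3 - x4 + x5 \<le> - kd"
      if "X \<le> - kd" "bd / 16 \<ge> 0" "x5 - x2 \<le> - (bd / 16)" "x1 + x3 \<le> x6" "x6 - x4 = X"
      for x1 x2 x3 x4 x5 x6 X kd bd :: real
      using that by linarith
    ultimately show ?thesis using B Q E unfolding r_def[symmetric] by (intro arith[where bd = "max b 0 * \<delta>"])
  qed
qed

section \<open>Change of the weight under a displacement\<close>

lemma ln_jacobi_weight:
  assumes "\<And>i j. i < n \<Longrightarrow> j < n \<Longrightarrow> i \<noteq> j \<Longrightarrow> v i \<noteq> v j"
    and "\<And>i. i < n \<Longrightarrow> -2 < v i \<and> v i < 2"
  shows "jacobi_weight n a b \<beta> v =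
     exp (\<beta> * (\<Sum>i<n. \<Sum>j\<in>{i<..<n}. ln \<bar>v i - v j\<bar>) + (\<Sum>i<n. a * ln (2 - v i) + b * ln (2 + v i)))"
proof -
  have "(\<Prod>i<n. \<Prod>j\<in>{i<..<n}. \<bar>v i - v j\<bar> powr \<beta>) = exp (\<beta> * (\<Sum>i<n. \<Sum>j\<in>{i<..<n}. ln \<bar>v i - v j\<bar>))"
    using assms(1) unfolding sum_distrib_left
    by (subst exp_sum, simp, intro prod.cong refl, subst exp_sum, simp)
       (auto simp: powr_def intro!: prod.cong)
  moreover have "(\<Prod>i<n. (2 - v i) powr a * (2 + v i) powr b * indicator {-2<..<2} (v i)) =
     exp (\<Sum>i<n. a * ln (2 - v i) + b * ln (2 + v i))"
    using assms(2) by (subst exp_sum, simp, intro prod.cong refl) (force simp: powr_def exp_add)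
  ultimately show ?thesis by (simp add: jacobi_weight_def exp_add)
qed

text \<open>
  \<open>R\<close> is the set of particles left in place. A pair of a moved particle \<open>i\<close> and some \<open>j \<in> R\<close> loses at
  least as much as if \<open>j\<close> sat exactly at the edge, because \<open>u j < 2\<close>.
\<close>

lemma jacobi_weight_shift:
  fixes y v u :: "nat \<Rightarrow> real" and a b \<beta> c c0 \<kappa> :: real
  assumes ab: "a > -1" "b > -1" "\<beta> > 0"
    and inj: "inj_on y {..<n}"
    and y: "\<And>i. i < n \<Longrightarrow> -2 < y i \<and> y i < 2"
    and R: "R \<subseteq> {..<n}" "\<And>i j. i \<in> {..<n} - R \<Longrightarrow> j \<in> R \<Longrightarrow> y i < y j"
           "\<And>j. j \<in> R \<Longrightarrow> 2 - y j \<le> c0" 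
    and st: "\<And>i. i < n \<Longrightarrow> \<beta> * (\<Sum>j\<in>{..<n} - {i}. 1 / (y i - y j)) = (a + 1) / (2 - y i) - (b + 1) / (2 + y i)"
    and q: "R \<noteq> {..<n} \<Longrightarrow> a + \<beta> * card R \<ge> 1"
    and c: "c > 0" "0 \<le> c0" "2 * c0 \<le> c" "\<kappa> \<ge> 0"
    and cases: "(b \<ge> 32 * \<kappa> \<and> c\<^sup>2 * b \<ge> 32) \<or> (R = {} \<and> c0 = 0 \<and> a \<ge> 32 * \<kappa> \<and> a * c \<ge> 8)"
    and e: "\<And>i. i < n \<Longrightarrow> v i \<le> u i" "\<And>i. i \<in> R \<Longrightarrow> u i = v i"
       "\<And>i. i < n \<Longrightarrow> v i < u i \<Longrightarrow> c < v i - y i"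
       "\<And>i j. i \<in> {..<n} - R \<Longrightarrow> j \<in> {..<n} - R \<Longrightarrow> v i - y i \<le> v j - y j \<Longrightarrow> u i - v i \<le> u j - v j"
    and u: "u \<in> chamber n y" "\<And>i. i < n \<Longrightarrow> -2 < u i \<and> u i < 2"
  shows "v \<in> chamber n y" "jacobi_weight n a b \<beta> u \<le> jacobi_weight n a b \<beta> v * exp (- (\<kappa> * c * (\<Sum>i<n. u i - v i)))"
proof -
  have uc: "u i < u j" if "i < n" "j < n" "y i < y j" for i j
    using u(1) that by (auto simp: chamber_def)
  \<comment> \<open>Undoing the displacement keeps the order. For two moved particles out of order,
    \<open>j\<close> would have the smaller excess over its target, hence by monotonicity the
    smaller displacement, and \<open>u\<close> would be out of order as well.\<close>
  have vc: "v i < v j" if ij: "i < n" "j < n" "y i < y j" for i j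
  proof (rule ccontr)
    assume "\<not> v i < v j"
    then have ge: "v j \<le> v i" by simp
    consider "i \<in> R" | "i \<notin> R" "j \<in> R" | "i \<notin> R" "j \<notin> R" by blast
    then show False
    proof cases
      case 1
      then have "j \<in> R" using R(2)[of j i] ij by force
      then show ?thesis using 1 e(2) uc[OF ij] ge by auto
    next
      case 2 then show ?thesis using e(1)[of i] e(2) uc[OF ij] ge ij by force
    next
      case 3 then show ?thesis using e(4)[of j i] uc[OF ij] ge ij by force
    qed
  qed
  then show "v \<in> chamber n y" by (auto simp: chamber_def)
  have vb: "-2 < v i \<and> v i < 2" if "i < n" for i
    using e(1,3)[of i] u(2)[of i] y[of i] that c by (cases "v i < u i") force+
  have yne: "y i \<noteq> y j" if "i < n" "j < n" "i \<noteq> j" for i j using inj that by (auto simp: inj_on_def)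
  have une: "u i \<noteq> u j" "v i \<noteq> v j" if "i < n" "j < n" "i \<noteq> j" for i j
    using yne[OF that] uc[of i j] uc[of j i] vc[of i j] vc[of j i] that by force+
  define l where "l i = ln (2 - u i) - ln (2 - v i)" for i
  define m where "m i = ln (2 + u i) - ln (2 + v i)" for i
  \<comment> \<open>\<open>h i j\<close> is the share of particle \<open>i\<close> in a bound for
    the interaction change of the pair: linearised at the targets if both move, the wall term
    \<open>l i\<close> if \<open>j\<close> is fixed, and nothing if \<open>i\<close> itself is
    fixed.\<close>
  define h where "h i j = (if i \<in> R then 0 else if j \<in> R then l i else (u i - v i) / (y i - y j))" for i j
  have l0: "l i \<le> 0" if "i < n" for i using e(1)[OF that] u(2)[OF that] by (simp add: l_def)
  have pair: "ln \<bar>u i - u j\<bar> - ln \<bar>v i - v j\<bar> \<le> h i j + h j i" if ij: "i < n" "j < n" "y i < y j" for i j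
  proof -
    have g: "u i < u j" "v i < v j" using uc vc ij by auto
    have ly: "h i j + h j i = (if j \<in> R then (if i \<in> R then 0 else l i) else ((u j - v j) - (u i - v i)) / (y j - y i))"
      using R(2)[of j i] ij by (auto simp: h_def divide_simps) (auto simp: algebra_simps)
    have eq: "ln \<bar>u i - u j\<bar> - ln \<bar>v i - v j\<bar> = ln ((u j - u i) / (v j - v i))"
      using g by (simp add: ln_div)
    show ?thesis
    proof (cases "j \<in> R")
      case True
      show ?thesis
      proof (cases "i \<in> R")
        case True then show ?thesis using ly eq \<open>j \<in> R\<close> e(2) by auto
      next
        case False
        have uj: "u j = v j" using True e(2) by auto
        have "(u j - u i) / (v j - v i) \<le> (2 - u i) / (2 - v i)"
        proof -
          have "0 \<le> (2 - u j) * (u i - v i)" using u(2)[OF ij(2)] e(1)[OF ij(1)] by (intro mult_nonneg_nonneg) auto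
          then show ?thesis using g vb[OF ij(1)] uj by (simp add: field_simps)
        qed
        then have "ln ((u j - u i) / (v j - v i)) \<le> ln ((2 - u i) / (2 - v i))"
          using g vb[OF ij(1)] u(2)[OF ij(1)] by (intro ln_mono) auto
        also have "\<dots> = l i" using vb[OF ij(1)] u(2)[OF ij(1)] by (simp add: l_def ln_div)
        finally show ?thesis using ly eq True False by simp
      qed
    next
      case False
      then have iR: "i \<notin> R" using R(2)[of j i] ij by force
      have "ln ((u j - u i) / (v j - v i)) \<le> (u j - u i) / (v j - v i) - 1"
        using g by (intro ln_le_minus_one) auto
      also have "\<dots> = ((u j - v j) - (u i - v i)) / (v j - v i)" using g by (simp add: field_simps)
      \<comment> \<open>By monotonicity the numerator is nonnegative when the gap of
        \<open>v\<close> is at least that of \<open>y\<close>, and nonpositive when it is smaller.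
        Passing to the gap of the targets therefore never decreases the quotient.\<close>
      also have "\<dots> \<le> ((u j - v j) - (u i - v i)) / (y j - y i)"
      proof (cases "v i - y i \<le> v j - y j")
        case True
        then show ?thesis using e(4)[of i j] iR False ij g by (intro divide_left_mono) auto
      next
        case F: False
        then show ?thesis using e(4)[of j i] iR False ij g by (intro divide_left_mono_neg) auto
      qed
      finally show ?thesis using ly eq False by simp
    qed
  qed
  have pair': "ln \<bar>u i - u j\<bar> - ln \<bar>v i - v j\<bar> \<le> h i j + h j i" if "i < n" "j < n" "i \<noteq> j" for i j
  proof (cases "y i < y j")
    case False
    then have "y j < y i" using yne[OF that] by simp
    then show ?thesis using pair[of j i] that by (simp add: abs_minus_commute add.commute)
  qed (use pair that in blast)
  have site: "\<beta> * (\<Sum>j\<in>{..<n} - {i}. h i j) + a * l i + b * m i \<le> - (\<kappa> * c * (u i - v i))" if i: "i < n" for i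
  proof (cases "v i < u i")
    case False
    then have eq: "u i = v i" using e(1)[OF i] by simp
    then have "h i j = 0" for j by (simp add: h_def l_def)
    then show ?thesis using eq by (simp add: l_def m_def)
  next
    case True
    define \<epsilon> where "\<epsilon> = u i - v i"
    have \<epsilon>: "\<epsilon> > 0" using True by (simp add: \<epsilon>_def)
    have iR: "i \<notin> R" using True e(2) by force
    have d: "c < v i - y i" using e(3)[OF i True] .
    note b3 = vb[OF i] u(2)[OF i] y[OF i]
    have fR: "finite R" using R(1) finite_subset by auto
    have split: "(\<Sum>j\<in>{..<n} - {i}. f j) = (\<Sum>j\<in>{..<n} - R - {i}. f j) + (\<Sum>j\<in>R. f j)" for f :: "nat \<Rightarrow> real"
      using R(1) iR fR by (subst sum.union_disjoint[symmetric]) (auto intro!: sum.cong)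
    define Y where "Y = (\<Sum>j\<in>{..<n} - R - {i}. 1 / (y i - y j))"
    have H: "(\<Sum>j\<in>{..<n} - {i}. h i j) = \<epsilon> * Y + card R * l i"
      unfolding split[of "h i"] Y_def sum_distrib_left using iR by (simp add: h_def \<epsilon>_def)
    define \<rho> where "\<rho> = 2 - y i"
    have rc: "\<rho> > c" "\<rho> < 4" using d b3 by (auto simp: \<rho>_def)
    have "- (\<Sum>j\<in>R. 1 / (y i - y j)) = (\<Sum>j\<in>R. 1 / (y j - y i))"
      by (subst sum_negf[symmetric], rule sum.cong) (auto simp: minus_divide_right)
    also have "\<dots> \<le> (\<Sum>j\<in>R. 1 / (\<rho> - c0))"
      using R(2)[of i] R(3) i iR rc c by (intro sum_mono divide_left_mono) (force simp: \<rho>_def)+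
    also have "\<dots> = card R / (\<rho> - c0)" by simp
    finally have S: "- (\<Sum>j\<in>R. 1 / (y i - y j)) \<le> card R / (\<rho> - c0)" .
    \<comment> \<open>Equilibrium trades the repulsion among moved targets for the edge forces at
      \<open>y i\<close>. The correction from the fixed targets is controlled because they lie
      within \<open>c0\<close> of the edge.\<close>
    have "\<beta> * Y = (a + 1) / \<rho> - (b + 1) / (4 - \<rho>) - \<beta> * (\<Sum>j\<in>R. 1 / (y i - y j))"
      using st[OF i] unfolding split Y_def[symmetric] by (simp add: \<rho>_def algebra_simps)
    also have "\<dots> \<le> (a + 1) / \<rho> - (b + 1) / (4 - \<rho>) + \<beta> * (card R / (\<rho> - c0))"
      using mult_left_mono[OF S, of \<beta>] ab by simp
    finally have Yb: "\<beta> * Y \<le> (a + 1) / \<rho> - (b + 1) / (4 - \<rho>) + \<beta> * card R / (\<rho> - c0)" by simp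
    have q1: "a + \<beta> * card R \<ge> 1" using q i iR by auto
    have "l i = ln ((2 - u i) / (2 - v i))" using b3 by (simp add: l_def ln_div)
    also have "\<dots> \<le> (2 - u i) / (2 - v i) - 1" using b3 by (intro ln_le_minus_one) auto
    also have "\<dots> = - \<epsilon> / (2 - v i)" using b3 by (simp add: \<epsilon>_def field_simps)
    finally have "(a + \<beta> * card R) * l i \<le> (a + \<beta> * card R) * (- \<epsilon> / (2 - v i))"
      using q1 by (intro mult_left_mono) auto
    also have "\<dots> = - (\<epsilon> * ((a + \<beta> * card R) / (2 - v i)))" by simp
    finally have L: "(a + \<beta> * card R) * l i \<le> - (\<epsilon> * ((a + \<beta> * card R) / (2 - v i)))" .
    have m0: "m i \<ge> 0" using b3 True by (simp add: m_def)
    have "m i = ln ((2 + u i) / (2 + v i))" using b3 by (simp add: m_def ln_div)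
    also have "\<dots> \<le> (2 + u i) / (2 + v i) - 1" using b3 by (intro ln_le_minus_one) auto
    also have "\<dots> = \<epsilon> / (2 + v i)" using b3 by (simp add: \<epsilon>_def field_simps)
    finally have m1: "m i \<le> \<epsilon> / (2 + v i)" .
    \<comment> \<open>For negative \<open>b\<close> the nonnegative increment \<open>m i\<close> can
      only lower the weight.\<close>
    have "b * m i \<le> max b 0 * m i" using m0 by (intro mult_right_mono) auto
    also have "\<dots> \<le> max b 0 * (\<epsilon> / (2 + v i))" using m1 by (intro mult_left_mono) auto
    finally have M: "b * m i \<le> \<epsilon> * (max b 0 / (2 + v i))" by (simp add: mult.commute)
    have "\<beta> * (\<epsilon> * Y + card R * l i) + a * l i + b * m i = \<epsilon> * (\<beta> * Y) + (a + \<beta> * card R) * l i + b * m i"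
      by (simp add: algebra_simps)
    also have "\<dots> \<le> \<epsilon> * ((a + 1) / \<rho> - (b + 1) / (4 - \<rho>) + \<beta> * card R / (\<rho> - c0) 
         - (a + \<beta> * card R) / (2 - v i) + max b 0 / (2 + v i))"
      unfolding distrib_left right_diff_distrib
      using L M mult_left_mono[OF Yb, of \<epsilon>] \<epsilon> unfolding distrib_left right_diff_distrib by linarith
    also have "\<dots> \<le> \<epsilon> * (- (\<kappa> * (v i - y i)))"
    proof (rule mult_left_mono)
      have "(a + 1) / \<rho> - (b + 1) / (4 - \<rho>) + (\<beta> * card R) / (\<rho> - c0) 
         - (a + \<beta> * card R) / (\<rho> - (v i - y i)) + max b 0 / (4 - \<rho> + (v i - y i)) \<le> - (\<kappa> * (v i - y i))"
        using cases d c rc b3 ab q1 by (intro force_bound[where c=c and c0=c0]) (auto simp: \<rho>_def)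
      then show "(a + 1) / \<rho> - (b + 1) / (4 - \<rho>) + \<beta> * card R / (\<rho> - c0) 
         - (a + \<beta> * card R) / (2 - v i) + max b 0 / (2 + v i) \<le> - (\<kappa> * (v i - y i))"
        by (simp add: \<rho>_def)
    qed (use \<epsilon> in simp)
    also have "\<dots> \<le> - (\<kappa> * c * \<epsilon>)"
      using mult_left_mono[of c "v i - y i" "\<epsilon> * \<kappa>"] d \<epsilon> c by (simp add: algebra_simps)
    finally show ?thesis unfolding H by (simp add: \<epsilon>_def)
  qed
  have "(\<beta> * (\<Sum>i<n. \<Sum>j\<in>{i<..<n}. ln \<bar>u i - u j\<bar>) + (\<Sum>i<n. a * ln (2 - u i) + b * ln (2 + u i)))
     - (\<beta> * (\<Sum>i<n. \<Sum>j\<in>{i<..<n}. ln \<bar>v i - v j\<bar>) + (\<Sum>i<n. a * ln (2 - v i) + b * ln (2 + v i)))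
     = \<beta> * (\<Sum>i<n. \<Sum>j\<in>{i<..<n}. ln \<bar>u i - u j\<bar> - ln \<bar>v i - v j\<bar>) + (\<Sum>i<n. a * l i + b * m i)"
    by (simp add: l_def m_def sum_subtractf sum.distrib algebra_simps sum_distrib_left)
  also have "\<dots> \<le> \<beta> * (\<Sum>i<n. \<Sum>j\<in>{i<..<n}. h i j + h j i) + (\<Sum>i<n. a * l i + b * m i)"
    using pair' ab by (intro add_right_mono mult_left_mono sum_mono) auto
  \<comment> \<open>Regrouping the shares by particle reduces the many-body estimate to the
    one-particle bound \<open>site\<close>.\<close>
  also have "\<dots> = (\<Sum>i<n. \<beta> * (\<Sum>j\<in>{..<n} - {i}. h i j) + a * l i + b * m i)"
    unfolding sum_offdiagonal by (simp add: sum.distrib sum_distrib_left)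
  also have "\<dots> \<le> (\<Sum>i<n. - (\<kappa> * c * (u i - v i)))"
    using site by (intro sum_mono) auto
  also have "\<dots> = - (\<kappa> * c * (\<Sum>i<n. u i - v i))" by (simp add: sum_negf sum_distrib_left)
  finally have F: "(\<beta> * (\<Sum>i<n. \<Sum>j\<in>{i<..<n}. ln \<bar>u i - u j\<bar>) + (\<Sum>i<n. a * ln (2 - u i) + b * ln (2 + u i)))
     \<le> (\<beta> * (\<Sum>i<n. \<Sum>j\<in>{i<..<n}. ln \<bar>v i - v j\<bar>) + (\<Sum>i<n. a * ln (2 - v i) + b * ln (2 + v i)))
       + (- (\<kappa> * c * (\<Sum>i<n. u i - v i)))" (is "?A \<le> ?B + ?C") by linarith
  have "jacobi_weight n a b \<beta> u = exp ?A" using une(1) u(2) by (rule ln_jacobi_weight)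
  moreover have "jacobi_weight n a b \<beta> v = exp ?B" using une(2) vb by (rule ln_jacobi_weight)
  ultimately show "jacobi_weight n a b \<beta> u \<le> jacobi_weight n a b \<beta> v * exp (- (\<kappa> * c * (\<Sum>i<n. u i - v i)))"
    using F by (simp only: exp_add[symmetric] exp_le_cancel_iff)
qed

section \<open>Change of variables and deviations on a chamber\<close>

text \<open>Lebesgue measure is determined by open intervals. The preimage of an interval under
  \<open>S\<close> is an interval, and the integral of \<open>S'\<close> over it is the increment of
  \<open>S\<close>.\<close>

lemma distr_increasing_density_lborel:
  fixes S S' :: "real \<Rightarrow> real"
  assumes D: "\<And>x. (S has_real_derivative S' x) (at x)"
    and pos: "\<And>x. 0 \<le> S' x" and mono: "strict_mono S" and surj: "surj S"
    and meas: "S' \<in> borel_measurable borel"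
  shows "distr (density lborel (\<lambda>x. ennreal (S' x))) borel S = lborel"
proof (rule lborel_eqI[symmetric])
  have cont: "continuous_on UNIV S" using D by (meson DERIV_isCont continuous_at_imp_continuous_on)
  have [measurable]: "S \<in> borel_measurable borel" "S' \<in> borel_measurable borel"
    using cont meas by (auto intro: borel_measurable_continuous_onI)
  fix l u :: real
  assume lu: "\<And>b. b \<in> Basis \<Longrightarrow> l \<bullet> b \<le> u \<bullet> b"
  then have lu: "l \<le> u" by simp
  obtain p q where pq: "S p = l" "S q = u" using surj by (metis surjD)
  have "p \<le> q" using lu pq mono by (metis strict_mono_less_eq)
  have vimage: "S -` {l<..<u} = {p<..<q}"
    using pq strict_mono_less[OF mono] by auto
  have "emeasure (distr (density lborel (\<lambda>x. ennreal (S' x))) borel S) (box l u)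
     = (\<integral>\<^sup>+x. ennreal (S' x) * indicator {p<..<q} x \<partial>lborel)"
    by (simp add: emeasure_distr emeasure_density vimage)
  also have "\<dots> = (\<integral>\<^sup>+x. ennreal (S' x) * indicator {p..q} x \<partial>lborel)"
    using AE_lborel_singleton[of p] AE_lborel_singleton[of q]
    by (intro nn_integral_cong_AE) (auto elim!: AE_mp simp: indicator_def)
  also have "\<dots> = S q - S p"
    using \<open>p \<le> q\<close> by (intro nn_integral_FTC_Icc) (auto simp: D pos intro: DERIV_subset)
  finally show "emeasure (distr (density lborel (\<lambda>x. ennreal (S' x))) borel S) (box l u) = (\<Prod>b\<in>Basis. (u - l) \<bullet> b)"
    using pq by simp
qed simp

text \<open>Each coordinate is transformed on its own, so the Jacobian is diagonal and comparing the
  measures on boxes suffices.\<close>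

lemma nn_integral_PiM_lborel_substitution:
  fixes S :: "'i \<Rightarrow> real \<Rightarrow> real" and g :: "'i \<Rightarrow> real \<Rightarrow> ennreal"
  assumes I: "finite I"
    and S[measurable]: "\<And>i. i \<in> I \<Longrightarrow> S i \<in> borel_measurable borel"
    and g[measurable]: "\<And>i. i \<in> I \<Longrightarrow> g i \<in> borel_measurable borel"
    and distr: "\<And>i. i \<in> I \<Longrightarrow> distr (density lborel (g i)) borel (S i) = lborel"
    and f[measurable]: "f \<in> borel_measurable (PiM I (\<lambda>_. lborel))"
  shows "(\<integral>\<^sup>+v. f v \<partial>PiM I (\<lambda>_. lborel)) =
    (\<integral>\<^sup>+v. (\<Prod>i\<in>I. g i (v i)) * f (\<lambda>i\<in>I. S i (v i)) \<partial>PiM I (\<lambda>_. lborel))"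
proof -
  interpret product_sigma_finite "\<lambda>_::'i. lborel :: real measure" ..
  let ?P = "PiM I (\<lambda>_. lborel :: real measure)"
  define T where "T v = (\<lambda>i\<in>I. S i (v i))" for v
  have [measurable]: "T \<in> measurable ?P ?P"
    unfolding T_def by (intro measurable_restrict) simp
  have [measurable]: "(\<lambda>v. \<Prod>i\<in>I. g i (v i)) \<in> borel_measurable ?P"
    by (intro borel_measurable_prod_ennreal) simp
  have "distr (density ?P (\<lambda>v. \<Prod>i\<in>I. g i (v i))) ?P T = ?P"
  proof (rule PiM_eqI[OF I])
    fix A :: "'i \<Rightarrow> real set"
    assume A: "\<And>i. i \<in> I \<Longrightarrow> A i \<in> sets lborel"
    have [measurable]: "Pi\<^sub>E I A \<in> sets ?P" using A I by (intro sets_PiM_I_finite) auto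
    have "emeasure (distr (density ?P (\<lambda>v. \<Prod>i\<in>I. g i (v i))) ?P T) (Pi\<^sub>E I A)
       = (\<integral>\<^sup>+v. (\<Prod>i\<in>I. g i (v i)) * indicator (T -` Pi\<^sub>E I A \<inter> space ?P) v \<partial>?P)"
      by (subst emeasure_distr, simp_all, subst emeasure_density, simp_all)
    also have "\<dots> = (\<integral>\<^sup>+v. (\<Prod>i\<in>I. g i (v i) * indicator (S i -` A i) (v i)) \<partial>?P)"
    proof (rule nn_integral_cong)
      fix v assume v: "v \<in> space ?P"
      have "indicator (T -` Pi\<^sub>E I A \<inter> space ?P) v = (\<Prod>i\<in>I. indicator (S i -` A i) (v i) :: ennreal)"
      proof (cases "\<forall>i\<in>I. S i (v i) \<in> A i")
        case True then show ?thesis using v by (simp add: T_def indicator_def PiE_iff)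
      next
        case False
        then obtain i where "i \<in> I" "S i (v i) \<notin> A i" by auto
        then have "(\<Prod>i\<in>I. indicator (S i -` A i) (v i) :: ennreal) = 0"
          using I by (intro prod_zero) (auto simp: indicator_def)
        then show ?thesis using False by (auto simp: T_def indicator_def PiE_iff)
      qed
      then show "(\<Prod>i\<in>I. g i (v i)) * indicator (T -` Pi\<^sub>E I A \<inter> space ?P) v
        = (\<Prod>i\<in>I. g i (v i) * indicator (S i -` A i) (v i))" by (simp add: prod.distrib)
    qed
    also have "\<dots> = (\<Prod>i\<in>I. \<integral>\<^sup>+t. g i t * indicator (S i -` A i) t \<partial>lborel)"
    proof (rule product_nn_integral_prod[OF I])
      fix i assume i: "i \<in> I"
      have [measurable]: "S i \<in> borel_measurable borel" "g i \<in> borel_measurable borel" "A i \<in> sets borel" 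
        using A i S g by auto
      show "(\<lambda>t. g i t * indicator (S i -` A i) t) \<in> borel_measurable lborel"
        using measurable_sets[OF S[OF i], of "A i"] by simp
    qed
    also have "\<dots> = (\<Prod>i\<in>I. emeasure lborel (A i))"
    proof (rule prod.cong[OF refl])
      fix i assume i: "i \<in> I"
      have [measurable]: "S i \<in> borel_measurable borel" "g i \<in> borel_measurable borel" "A i \<in> sets borel" 
        using A i S g by auto
      have [measurable]: "S i -` A i \<in> sets borel" using measurable_sets[OF S[OF i], of "A i"] by simp
      have "emeasure lborel (A i) = emeasure (distr (density lborel (g i)) borel (S i)) (A i)"
        using distr[OF i] by simp
      also have "\<dots> = (\<integral>\<^sup>+t. g i t * indicator (S i -` A i) t \<partial>lborel)"
        by (simp add: emeasure_distr emeasure_density)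
      finally show "(\<integral>\<^sup>+t. g i t * indicator (S i -` A i) t \<partial>lborel) = emeasure lborel (A i)" ..
    qed
    finally show "emeasure (distr (density ?P (\<lambda>v. \<Prod>i\<in>I. g i (v i))) ?P T) (Pi\<^sub>E I A)
       = (\<Prod>i\<in>I. emeasure lborel (A i))" .
  qed simp
  then have "(\<integral>\<^sup>+v. f v \<partial>?P) = (\<integral>\<^sup>+v. f v \<partial>distr (density ?P (\<lambda>v. \<Prod>i\<in>I. g i (v i))) ?P T)" by simp
  also have "\<dots> = (\<integral>\<^sup>+v. (\<Prod>i\<in>I. g i (v i)) * f (T v) \<partial>?P)"
    by (subst nn_integral_distr, simp, simp, subst nn_integral_density) simp_all
  finally show ?thesis by (simp add: T_def)
qed

text \<open>The derivative of cosh vanishes at 0, so it can be continued to the left by the constant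
  1 without a kink.\<close>

lemma has_real_derivative_cosh_positive_part:
  "((\<lambda>t. cosh (\<theta> * max 0 t)) has_real_derivative \<theta> * sinh (\<theta> * max 0 t)) (at (t::real))"
proof -
  have pos: "((\<lambda>t. cosh (\<theta> * t)) has_real_derivative \<theta> * sinh (\<theta> * t)) (at t)" for t :: real
    by (auto intro!: derivative_eq_intros)
  consider "t < 0" | "t = 0" | "t > 0" by linarith
  then show ?thesis
  proof cases
    case 1
    have "eventually (\<lambda>s. s < 0) (nhds t)" using 1 by (intro eventually_nhds_in_open[of "{..<0}", simplified]) auto
    then have "eventually (\<lambda>s. cosh (\<theta> * max 0 s) = 1) (nhds t)" by eventually_elim simp
    then show ?thesis using 1 by (subst DERIV_cong_ev[where g = "\<lambda>_. 1"]) auto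
  next
    case 3
    have "eventually (\<lambda>s. s > 0) (nhds t)" using 3 by (intro eventually_nhds_in_open[of "{0<..}", simplified]) auto
    then have "eventually (\<lambda>s. cosh (\<theta> * max 0 s) = cosh (\<theta> * s)) (nhds t)" by eventually_elim simp
    then show ?thesis using 3 pos[of t] by (subst DERIV_cong_ev[where g = "\<lambda>s. cosh (\<theta> * s)"]) auto
  next
    case 2
    have lim: "((\<lambda>y. (cosh (\<theta> * y) - 1) / y) \<longlongrightarrow> 0) (at 0)"
      using pos[of 0] by (simp add: has_field_derivative_iff)
    have "((\<lambda>y. (cosh (\<theta> * max 0 y) - 1) / y) \<longlongrightarrow> 0) (at 0)"
      by (rule Lim_null_comparison[OF _ tendsto_norm_zero[OF lim]]) (auto intro!: always_eventually divide_nonneg_neg simp: max_def)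
    then show ?thesis using 2 by (simp add: has_field_derivative_iff)
  qed
qed

section \<open>Upward deviations on one chamber\<close>

lemma jacobi_weight_nonneg: "0 \<le> jacobi_weight n a b \<beta> v"
  unfolding jacobi_weight_def by (intro mult_nonneg_nonneg prod_nonneg) (auto intro!: prod_nonneg)

lemma jacobi_weight_measurable [measurable]:
  "jacobi_weight n a b \<beta> \<in> borel_measurable (PiM {..<n} (\<lambda>_. lborel))"
  unfolding jacobi_weight_def by measurable

lemma chamber_pred_measurable [measurable]:
  "Measurable.pred (PiM {..<n} (\<lambda>_. lborel)) (\<lambda>v. v \<in> chamber n y)"
  unfolding chamber_def mem_Collect_eq by measurable auto

lemma jacobi_weight_nonzeroD:
  assumes "jacobi_weight n a b \<beta> v \<noteq> 0" "i < n"
  shows "-2 < v i" "v i < 2"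
  using assms by (auto simp: jacobi_weight_def indicator_def split: if_splits)

text \<open>Let \<open>Z\<close> be the mass of the chamber and \<open>I\<close> that of the
  deviation event. Displacing every configuration and changing variables gives
  \<open>Z \<le> exp (s * n) * (Z - \<eta> * I)\<close>, because the event loses a fixed fraction of
  its mass. Solving for \<open>I\<close> gives a bound 2 s n Z with s = 1 /
  \<open>x0\<close>.\<close>

lemma upper_chamber_bound:
  fixes y :: "nat \<Rightarrow> real" and a b \<beta> c c0 \<kappa> :: real
  assumes ab: "a > -1" "b > -1" "\<beta> > 0"
    and inj: "inj_on y {..<n}"
    and y: "\<And>i. i < n \<Longrightarrow> -2 < y i \<and> y i < 2"
    and R: "R \<subseteq> {..<n}" "\<And>i j. i \<in> {..<n} - R \<Longrightarrow> j \<in> R \<Longrightarrow> y i < y j"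
           "\<And>j. j \<in> R \<Longrightarrow> 2 - y j \<le> c0" 
    and st: "\<And>i. i < n \<Longrightarrow> \<beta> * (\<Sum>j\<in>{..<n} - {i}. 1 / (y i - y j)) = (a + 1) / (2 - y i) - (b + 1) / (2 + y i)"
    and q: "R \<noteq> {..<n} \<Longrightarrow> a + \<beta> * card R \<ge> 1"
    and c: "c > 0" "0 \<le> c0" "2 * c0 \<le> c" "\<kappa> > 0"
    and cases: "(b \<ge> 32 * \<kappa> \<and> c\<^sup>2 * b \<ge> 32) \<or> (R = {} \<and> c0 = 0 \<and> a \<ge> 32 * \<kappa> \<and> a * c \<ge> 8)"
    and fin: "(\<integral>\<^sup>+v. ennreal (jacobi_weight n a b \<beta> v) * indicator (chamber n y) v \<partial>PiM {..<n} (\<lambda>_. lborel)) < \<infinity>"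
  shows "(\<integral>\<^sup>+v. ennreal (jacobi_weight n a b \<beta> v) * indicator (chamber n y) v * indicator {v. \<exists>i<n. 2 * c \<le> v i - y i} v \<partial>PiM {..<n} (\<lambda>_. lborel))
     \<le> ennreal (2 * real n / (cosh (\<kappa> * c\<^sup>2 / 2) - 1)) *
       (\<integral>\<^sup>+v. ennreal (jacobi_weight n a b \<beta> v) * indicator (chamber n y) v \<partial>PiM {..<n} (\<lambda>_. lborel))"
proof -
  let ?P = "PiM {..<n} (\<lambda>_. lborel :: real measure)"
  define F where "F v = (if v \<in> chamber n y then jacobi_weight n a b \<beta> v else 0)" for v
  define B where "B = {v. \<exists>i<n. 2 * c \<le> v i - y i}"
  have [measurable]: "F \<in> borel_measurable ?P" unfolding F_def by measurable
  have "Measurable.pred ?P (\<lambda>v. \<exists>i\<in>{..<n}. 2 * c \<le> v i - y i)"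
    by (intro pred_intros_finite) measurable
  then have [measurable]: "Measurable.pred ?P (\<lambda>v. v \<in> B)" by (simp add: B_def Bex_def)
  have F0: "0 \<le> F v" for v by (simp add: F_def jacobi_weight_nonneg)
  have eF: "ennreal (jacobi_weight n a b \<beta> v) * indicator (chamber n y) v = ennreal (F v)" for v
    by (simp add: F_def indicator_def)
  have eFB: "ennreal (F v) * indicator B v = ennreal (F v * indicator B v)" for v
    by (simp add: indicator_def)
  define K where "K = {..<n} - R"
  \<comment> \<open>At this rate the weight loses 2 s X in the exponent while the Jacobian gains at
    most s (X + n), thanks to \<open>\<phi>' t \<le> \<theta> * (\<phi> t + 1)\<close>.\<close>
  define \<theta> where "\<theta> = \<kappa> * c / 2"
  have \<theta>: "\<theta> > 0" using c by (simp add: \<theta>_def)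
  define \<phi> where "\<phi> t = cosh (\<theta> * max 0 (t - c)) - 1" for t
  define \<phi>' where "\<phi>' t = \<theta> * sinh (\<theta> * max 0 (t - c))" for t
  have D\<phi>: "(\<phi> has_real_derivative \<phi>' t) (at t)" for t
  proof -
    have "((\<lambda>t. cosh (\<theta> * max 0 t) - 1) has_real_derivative \<theta> * sinh (\<theta> * max 0 (t - c))) (at (t - c))"
      using DERIV_diff[OF has_real_derivative_cosh_positive_part[of \<theta> "t - c"] DERIV_const[of 1]] by simp
    then show ?thesis
      using DERIV_shift[of "\<lambda>t. cosh (\<theta> * max 0 t) - 1" "\<theta> * sinh (\<theta> * max 0 (t - c))" t "-c"]
      by (simp add: \<phi>_def[abs_def] \<phi>'_def)
  qed
  have \<phi>0: "\<phi> t \<ge> 0" for t by (simp add: \<phi>_def cosh_real_ge_1)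
  have \<phi>'0: "\<phi>' t \<ge> 0" for t using \<theta> by (simp add: \<phi>'_def)
  have \<phi>mono: "\<phi> s \<le> \<phi> t" if "s \<le> t" for s t
    using that \<theta> by (auto simp: \<phi>_def cosh_real_nonneg_le_iff)
  have \<phi>pos: "c < t" if "\<phi> t > 0" for t using that by (cases "c < t") (auto simp: \<phi>_def max_absorb1)
  have \<phi>': "\<phi>' t \<le> \<theta> * (\<phi> t + 1)" for t
    using \<theta> sinh_less_cosh_real[of "\<theta> * max 0 (t - c)"] by (simp add: \<phi>'_def \<phi>_def)
  have [measurable]: "\<phi> \<in> borel_measurable borel" "\<phi>' \<in> borel_measurable borel"
    unfolding \<phi>_def[abs_def] \<phi>'_def[abs_def] cosh_def sinh_def by measurable
  define X where "X v = (\<Sum>i\<in>K. \<phi> (v i - y i))" for v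
  have X0: "X v \<ge> 0" for v unfolding X_def by (intro sum_nonneg \<phi>0)
  \<comment> \<open>The value of \<open>\<phi>\<close> at \<open>2 * c\<close>, since
    \<open>\<theta> * c = \<kappa> * c\<^sup>2 / 2\<close>.\<close>
  define x0 where "x0 = cosh (\<kappa> * c\<^sup>2 / 2) - 1"
  have x0: "x0 > 0" using c cosh_real_strict_mono[of 0 "\<kappa> * c\<^sup>2 / 2"] by (simp add: x0_def)
  \<comment> \<open>Normalised so that s X is at least 1 as soon as one moved particle exceeds its
    target by \<open>2 * c\<close>.\<close>
  define s where "s = 1 / x0"
  have s: "s > 0" "s * x0 = 1" using x0 by (auto simp: s_def)
  define \<tau> where "\<tau> = s / \<theta>"
  have \<tau>: "\<tau> > 0" "\<tau> * \<theta> = s" using s \<theta> by (auto simp: \<tau>_def)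
  define S where "S i t = (if i \<in> K then t + \<tau> * \<phi> (t - y i) else t)" for i t
  define S' where "S' i t = (if i \<in> K then 1 + \<tau> * \<phi>' (t - y i) else 1)" for i t
  have S'0: "S' i t \<ge> 0" for i t using \<tau> \<phi>'0 by (simp add: S'_def)
  have DS: "(S i has_real_derivative S' i t) (at t)" for i t
  proof -
    have "((\<lambda>t. \<phi> (t - y i)) has_real_derivative \<phi>' (t - y i)) (at t)"
      using DERIV_shift[of \<phi> "\<phi>' (t - y i)" t "- y i"] D\<phi> by simp
    then show ?thesis unfolding S_def[abs_def] S'_def
      by (cases "i \<in> K") (auto intro!: derivative_eq_intros)
  qed
  have [measurable]: "S i \<in> borel_measurable borel" "S' i \<in> borel_measurable borel" for i
    unfolding S_def[abs_def] S'_def[abs_def] by measurable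
  have distr: "distr (density lborel (\<lambda>x. ennreal (S' i x))) borel (S i) = lborel" for i
  proof (rule distr_increasing_density_lborel[OF DS S'0])
    show "strict_mono (S i)"
    proof (rule strict_monoI)
      fix p q :: real assume "p < q"
      moreover have "\<tau> * \<phi> (p - y i) \<le> \<tau> * \<phi> (q - y i)" using \<open>p < q\<close> \<tau> by (intro mult_left_mono \<phi>mono) auto
      ultimately show "S i p < S i q" by (simp add: S_def)
    qed
    have le: "t \<le> S i t" for t using \<tau> \<phi>0 by (simp add: S_def)
    have eq: "S i t = t" if "t \<le> y i + c" for t using that by (simp add: S_def \<phi>_def max_def)
    have cont: "isCont (S i) t" for t using DS DERIV_isCont by blast
    show "surj (S i)"
    proof (rule surjI)
      fix z :: real
      have "\<exists>t. S i t = z"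
      proof (cases "z \<le> y i + c")
        case True then show ?thesis using eq by blast
      next
        case False
        then have "\<exists>t. y i + c \<le> t \<and> t \<le> z \<and> S i t = z"
          using eq[of "y i + c"] le[of z] cont by (intro IVT) auto
        then show ?thesis by blast
      qed
      then show "S i (SOME t. S i t = z) = z" by (rule someI_ex)
    qed
  qed simp
  \<comment> \<open>Weight loss and Jacobian combine pointwise into the factor exp (s (n - X)).
    Displaced points of zero weight satisfy the bound trivially.\<close>
  have key: "(\<Prod>i<n. ennreal (S' i (v i))) * ennreal (F (\<lambda>i\<in>{..<n}. S i (v i))) \<le> ennreal (F v * exp (s * (n - X v)))" for v
  proof -
    define u where "u = (\<lambda>i\<in>{..<n}. S i (v i))"
    show ?thesis
    proof (cases "F u = 0")
      case True then show ?thesis using F0 by (simp add: u_def)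
    next
      case False
      then have uC: "u \<in> chamber n y" and un: "jacobi_weight n a b \<beta> u \<noteq> 0" by (auto simp: F_def split: if_splits)
      have ui: "u i - v i = (if i \<in> K then \<tau> * \<phi> (v i - y i) else 0)" if "i < n" for i
        using that by (simp add: u_def S_def)
      note sh = jacobi_weight_shift[OF ab inj y R st q, where u = u and v = v and c = c and \<kappa> = \<kappa>]
      have e1: "v i \<le> u i" if "i < n" for i
      proof -
        have "0 \<le> u i - v i" unfolding ui[OF that] using \<tau> \<phi>0 by simp
        then show ?thesis by simp
      qed
      have e2: "u i = v i" if "i \<in> R" for i using that R(1) by (auto simp: u_def S_def K_def)
      have e3: "c < v i - y i" if "i < n" "v i < u i" for i
      proof -
        have "u i - v i > 0" using that by simp
        then have "\<phi> (v i - y i) > 0" unfolding ui[OF that(1)] using \<tau> by (simp add: zero_less_mult_iff split: if_splits)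
        then show ?thesis by (rule \<phi>pos)
      qed
      have e4: "u i - v i \<le> u j - v j" if "i \<in> {..<n} - R" "j \<in> {..<n} - R" "v i - y i \<le> v j - y j" for i j
        using that ui[of i] ui[of j] \<tau> by (auto simp: K_def intro!: mult_left_mono \<phi>mono)
      have sh1: "v \<in> chamber n y" and sh2: "jacobi_weight n a b \<beta> u \<le> jacobi_weight n a b \<beta> v * exp (- (\<kappa> * c * (\<Sum>i<n. u i - v i)))"
        using c cases e1 e2 e3 e4 uC jacobi_weight_nonzeroD[OF un]
        by (intro sh; auto)+
      have "(\<Sum>i<n. u i - v i) = (\<Sum>i<n. if i \<in> K then \<tau> * \<phi> (v i - y i) else 0)" using ui by (intro sum.cong) auto
      also have "\<dots> = (\<Sum>i\<in>K. \<tau> * \<phi> (v i - y i))"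
        by (subst sum.inter_restrict[symmetric]) (auto simp: K_def intro!: sum.cong)
      also have "\<dots> = \<tau> * X v" by (simp add: X_def sum_distrib_left)
      finally have "\<kappa> * c * (\<Sum>i<n. u i - v i) = 2 * s * X v"
        using \<tau>(2) by (simp add: \<theta>_def mult_ac)
      then have Fu: "F u \<le> F v * exp (- (2 * s * X v))" using sh1 sh2 uC by (simp add: F_def)
      have "(\<Prod>i<n. S' i (v i)) = (\<Prod>i\<in>K. 1 + \<tau> * \<phi>' (v i - y i))"
        unfolding S'_def by (subst prod.inter_restrict[symmetric]) (auto simp: K_def intro!: prod.cong)
      also have "\<dots> \<le> (\<Prod>i\<in>K. exp (s * (\<phi> (v i - y i) + 1)))"
      proof (rule prod_mono, intro conjI)
        fix i
        show "0 \<le> 1 + \<tau> * \<phi>' (v i - y i)" using \<tau> \<phi>'0 by simp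
        have "\<tau> * \<phi>' (v i - y i) \<le> \<tau> * (\<theta> * (\<phi> (v i - y i) + 1))" using \<tau> \<phi>' by (intro mult_left_mono) auto
        also have "\<dots> = s * (\<phi> (v i - y i) + 1)" using \<tau>(2) by (metis mult.assoc)
        finally show "1 + \<tau> * \<phi>' (v i - y i) \<le> exp (s * (\<phi> (v i - y i) + 1))"
          using exp_ge_add_one_self[of "s * (\<phi> (v i - y i) + 1)"] by linarith
      qed
      also have "\<dots> = exp (s * (X v + card K))"
        by (subst exp_sum[symmetric]) (auto simp: K_def X_def sum_distrib_left[symmetric] sum.distrib)
      also have "\<dots> \<le> exp (s * (X v + n))"
        using s card_mono[of "{..<n}" K] by (auto simp: K_def intro!: mult_left_mono)
      finally have "(\<Prod>i<n. S' i (v i)) * F u \<le> exp (s * (X v + n)) * (F v * exp (- (2 * s * X v)))"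
        using Fu F0 by (intro mult_mono) auto
      also have "\<dots> = F v * exp (s * (n - X v))"
        by (simp add: mult.left_commute exp_add[symmetric] algebra_simps)
      finally show ?thesis unfolding u_def[symmetric] using F0 S'0
        by (simp add: prod_ennreal ennreal_mult'[symmetric] prod_nonneg)
    qed
  qed
  have low: "X v \<ge> x0" if "v \<in> B" "F v \<noteq> 0" for v
  proof -
    obtain i where i: "i < n" "2 * c \<le> v i - y i" using \<open>v \<in> B\<close> by (auto simp: B_def)
    have "v i < 2" using that(2) i jacobi_weight_nonzeroD[of n a b \<beta> v i] by (auto simp: F_def split: if_splits)
    \<comment> \<open>The target of a fixed particle is within \<open>c0\<close>, hence less than
      \<open>2 * c\<close>, of the edge, so the particle cannot lie \<open>2 * c\<close> above
      it.\<close>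
    then have "i \<notin> R" using R(3)[of i] i c by force
    then have "\<phi> (v i - y i) \<le> X v" unfolding X_def using i \<phi>0 by (intro member_le_sum) (auto simp: K_def)
    moreover have "\<phi> (2 * c) = x0" using c by (simp add: \<phi>_def x0_def \<theta>_def max_def power2_eq_square)
    ultimately show ?thesis using \<phi>mono[OF i(2)] by linarith
  qed
  \<comment> \<open>The fraction lost on the event, where s X is at least 1.\<close>
  define \<eta> :: real where "\<eta> = 1 - exp (-1)"
  have eta: "\<eta> \<ge> 1/2" "\<eta> \<le> 1" using exp_ge_add_one_self[of 1] by (auto simp: \<eta>_def exp_minus field_simps)
  have pt: "F v * exp (s * (n - X v)) \<le> exp (s * n) * (F v * (1 - \<eta> * indicator B v))" for v
  proof (cases "F v = 0")
    case False
    have "exp (- (s * X v)) \<le> 1 - \<eta> * indicator B v"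
    proof (cases "v \<in> B")
      case True
      have "s * x0 \<le> s * X v" using low[OF True False] s by (intro mult_left_mono) auto
      then show ?thesis using True s by (simp add: \<eta>_def)
    qed (use s X0 in simp)
    then have "F v * (exp (s * n) * exp (- (s * X v))) \<le> F v * (exp (s * n) * (1 - \<eta> * indicator B v))"
      using F0 by (intro mult_left_mono) auto
    then show ?thesis by (simp add: exp_add[symmetric] algebra_simps)
  qed simp
  define Z where "Z = (\<integral>\<^sup>+v. ennreal (F v) \<partial>?P)"
  define I where "I = (\<integral>\<^sup>+v. ennreal (F v * indicator B v) \<partial>?P)"
  define J where "J = (\<integral>\<^sup>+v. ennreal (F v * (1 - \<eta> * indicator B v)) \<partial>?P)"
  have Zfin: "Z < \<infinity>" using fin by (simp add: eF Z_def)
  have IB: "I \<le> Z" unfolding I_def Z_def by (intro nn_integral_mono ennreal_leI) (simp add: indicator_def F0)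
  have JI: "J + ennreal \<eta> * I = Z"
  proof -
    have nonneg: "0 \<le> F v * (1 - \<eta> * indicator B v)" "0 \<le> F v * indicator B v" for v
      using F0 eta by (auto simp: indicator_def)
    have "J + ennreal \<eta> * I = (\<integral>\<^sup>+v. ennreal (F v * (1 - \<eta> * indicator B v)) + ennreal \<eta> * ennreal (F v * indicator B v) \<partial>?P)"
      unfolding J_def I_def by (subst nn_integral_add, simp, simp, subst nn_integral_cmult) simp_all
    also have "\<dots> = Z" unfolding Z_def
      using nonneg eta by (intro nn_integral_cong) (simp add: ennreal_mult'[symmetric] ennreal_plus[symmetric] algebra_simps del: ennreal_plus)
    finally show ?thesis .
  qed
  \<comment> \<open>The substitution preserves the total mass, so the displaced integrand, weighted
    by the Jacobian, again integrates to \<open>Z\<close>.\<close>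
  have "Z = (\<integral>\<^sup>+v. (\<Prod>i<n. ennreal (S' i (v i))) * ennreal (F (\<lambda>i\<in>{..<n}. S i (v i))) \<partial>?P)"
    unfolding Z_def using distr by (intro nn_integral_PiM_lborel_substitution) auto
  also have "\<dots> \<le> (\<integral>\<^sup>+v. ennreal (exp (s * n)) * ennreal (F v * (1 - \<eta> * indicator B v)) \<partial>?P)"
    using order_trans[OF key ennreal_leI[OF pt]] by (intro nn_integral_mono) (simp add: ennreal_mult'[symmetric])
  also have "\<dots> = ennreal (exp (s * n)) * J" unfolding J_def by (rule nn_integral_cmult) simp
  finally have main: "Z \<le> ennreal (exp (s * n)) * J" .
  \<comment> \<open>Finiteness of \<open>Z\<close> permits passing to real numbers, where
    \<open>I\<close> can be isolated by subtraction.\<close>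
  obtain z where z: "Z = ennreal z" "z \<ge> 0" using Zfin by (cases Z) auto
  obtain r where r: "I = ennreal r" "r \<ge> 0" using IB Zfin by (cases I) auto
  have "J \<le> Z" using JI by (metis le_iff_add)
  then obtain j where j: "J = ennreal j" "j \<ge> 0" using Zfin by (cases J) auto
  have e1: "j + \<eta> * r = z" using JI eta unfolding z r j by (simp add: ennreal_mult'[symmetric] ennreal_plus[symmetric] r(2) j(2) z(2) del: ennreal_plus)
  have e2: "z \<le> exp (s * n) * j" using main z j by (simp add: ennreal_mult'[symmetric])
  have "z * exp (- (s * n)) \<le> j" using e2 by (simp add: exp_minus field_simps)
  moreover have "z * (1 - s * n) \<le> z * exp (- (s * n))" using exp_ge_add_one_self[of "- (s * n)"] z by (intro mult_left_mono) auto
  ultimately have "\<eta> * r \<le> s * n * z" using e1 by (simp add: algebra_simps)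
  moreover have "r / 2 \<le> \<eta> * r" using eta r mult_right_mono[of "1/2" \<eta> r] by simp
  ultimately have "r \<le> 2 * (s * n * z)" by linarith
  then have "r \<le> 2 * real n / x0 * z" by (simp add: s_def)
  then have "I \<le> ennreal (2 * real n / x0) * Z" using x0 unfolding z r by (simp add: ennreal_mult'[symmetric] z(2) ennreal_leI)
  then show ?thesis unfolding eF B_def[symmetric] eFB I_def Z_def x0_def .
qed

section \<open>Zeros close to the edge\<close>

lemma sum_offdiagonal_swap:
  fixes f :: "'i \<Rightarrow> 'i \<Rightarrow> real"
  assumes "finite R"
  shows "(\<Sum>i\<in>R. \<Sum>j\<in>R - {i}. f j i) = (\<Sum>i\<in>R. \<Sum>j\<in>R - {i}. f i j)"
proof -
  have "R - {i} = {j\<in>R. j \<noteq> i}" "R - {i} = {j\<in>R. i \<noteq> j}" for i by auto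
  then show ?thesis using sum.swap_restrict[OF assms assms, of "\<lambda>i j. f j i" "\<lambda>i j. i \<noteq> j"]
    by (metis (no_types, lifting) sum.cong)
qed

text \<open>By convexity the slope of a chord is at most the derivative at its larger end; adding
  the other end makes the bound symmetric.\<close>

lemma exp_chord_le:
  fixes p q s :: real
  assumes "s > 0" "p \<noteq> q"
  shows "(exp (s * p) - exp (s * q)) / (p - q) \<le> s * (exp (s * p) + exp (s * q))"
proof -
  have *: "(exp (s * p) - exp (s * q)) / (p - q) \<le> s * exp (s * p)" if "q < p" for p q
  proof -
    have "1 + (s * q - s * p) \<le> exp (s * q - s * p)" by (rule exp_ge_add_one_self)
    then have "exp (s * p) * (1 + (s * q - s * p)) \<le> exp (s * p) * exp (s * q - s * p)" by (intro mult_left_mono) auto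
    then have "exp (s * p) - exp (s * q) \<le> s * exp (s * p) * (p - q)"
      by (simp add: exp_add[symmetric] algebra_simps)
    then show ?thesis using that by (simp add: divide_le_eq)
  qed
  have pos: "s * exp (s * p) \<ge> 0" "s * exp (s * q) \<ge> 0" using assms by auto
  show ?thesis
  proof (cases "q < p")
    case True then show ?thesis using *[OF True] pos by (simp add: distrib_left)
  next
    case False
    then have "p < q" using assms by simp
    moreover have "(exp (s * p) - exp (s * q)) / (p - q) = (exp (s * q) - exp (s * p)) / (q - p)"
      by (metis minus_diff_eq minus_divide_divide)
    ultimately show ?thesis using *[of p q] pos by (simp add: distrib_left)
  qed
qed

text \<open>
  Test the equilibrium equations of the topmost zeros against \<open>exp (s \<rho>) - 1\<close> with \<open>s = (b + 1) / 16\<close>;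
  the zeros below only push upwards and can be dropped.
\<close>

lemma edge_roots_bound:
  fixes y :: "nat \<Rightarrow> real" and a b \<beta> :: real
  assumes ab: "a > -1" "b > -1" "\<beta> > 0"
    and inj: "inj_on y {..<n}"
    and y: "\<And>i. i < n \<Longrightarrow> -2 < y i \<and> y i < 2"
    and R: "R \<subseteq> {..<n}" "\<And>i j. i \<in> {..<n} - R \<Longrightarrow> j \<in> R \<Longrightarrow> y i < y j" "R \<noteq> {}"
    and st: "\<And>i. i < n \<Longrightarrow> \<beta> * (\<Sum>j\<in>{..<n} - {i}. 1 / (y i - y j)) = (a + 1) / (2 - y i) - (b + 1) / (2 + y i)"
    and q: "a + \<beta> * (real (card R) - 1) \<le> 1"
    and j: "j \<in> R"
  shows "2 - y j \<le> 16 * ln (2 * card R) / (b + 1)"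
proof -
  have fR: "finite R" using R(1) by (rule finite_subset) simp
  have k: "card R \<ge> 1" using R fR by (simp add: card_gt_0_iff Suc_leI)
  define \<rho> where "\<rho> i = 2 - y i" for i
  define s where "s = (b + 1) / 16"
  have s: "s > 0" using ab by (simp add: s_def)
  define E where "E i = exp (s * \<rho> i)" for i
  have \<rho>: "0 < \<rho> i" "\<rho> i < 4" if "i \<in> R" for i using y[of i] R(1) that by (auto simp: \<rho>_def)
  have E1: "E i \<ge> 1" if "i \<in> R" for i using \<rho>[OF that] s by (simp add: E_def)
  have ne: "\<rho> i \<noteq> \<rho> j" if "i \<in> R" "j \<in> R" "i \<noteq> j" for i j
    using inj that R(1) by (auto simp: \<rho>_def inj_on_def subset_eq)
  have force: "(b + 1) / 4 \<le> (a + 1) / \<rho> i + \<beta> * (\<Sum>j\<in>R - {i}. 1 / (\<rho> i - \<rho> j))" if i: "i \<in> R" for i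
  proof -
    have "{..<n} - {i} = (R - {i}) \<union> ({..<n} - R)" using i R(1) by auto
    then have "(\<Sum>j\<in>{..<n} - {i}. 1 / (y i - y j)) = (\<Sum>j\<in>R - {i}. 1 / (y i - y j)) + (\<Sum>j\<in>{..<n} - R. 1 / (y i - y j))"
      using fR by (simp only:) (rule sum.union_disjoint, auto)
    moreover have "(\<Sum>j\<in>{..<n} - R. 1 / (y i - y j)) \<ge> 0"
      by (intro sum_nonneg) (use R(2)[OF _ i] in force)
    moreover have "(\<Sum>j\<in>R - {i}. 1 / (y i - y j)) = - (\<Sum>j\<in>R - {i}. 1 / (\<rho> i - \<rho> j))"
      unfolding sum_negf[symmetric] by (intro sum.cong) (auto simp: \<rho>_def minus_divide_right)
    ultimately have "- (\<Sum>j\<in>{..<n} - {i}. 1 / (y i - y j)) \<le> (\<Sum>j\<in>R - {i}. 1 / (\<rho> i - \<rho> j))" by linarith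
    then have "\<beta> * (- (\<Sum>j\<in>{..<n} - {i}. 1 / (y i - y j))) \<le> \<beta> * (\<Sum>j\<in>R - {i}. 1 / (\<rho> i - \<rho> j))"
      using ab by (intro mult_left_mono) auto
    moreover have "(b + 1) / 4 \<le> (b + 1) / (2 + y i)"
      using ab \<rho>[OF i] by (intro divide_left_mono) (auto simp: \<rho>_def)
    moreover have "\<beta> * (\<Sum>j\<in>{..<n} - {i}. 1 / (y i - y j)) = (a + 1) / \<rho> i - (b + 1) / (2 + y i)"
      using st[of i] i R(1) by (auto simp: \<rho>_def)
    moreover have "w \<le> p + t" if "- s \<le> t" "w \<le> q" "s = p - q" for w p q s t :: real
      using that by linarith
    ultimately show ?thesis by (simp only: mult_minus_right)
  qed
  \<comment> \<open>Symmetrising in \<open>i\<close> and \<open>j\<close> turns the terms into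
    difference quotients of \<open>E\<close>, to which \<open>exp_chord_le\<close> applies.\<close>
  have pairs: "(\<Sum>i\<in>R. \<Sum>j\<in>R - {i}. (E i - 1) / (\<rho> i - \<rho> j)) \<le> s * (real (card R) - 1) * (\<Sum>i\<in>R. E i)"
  proof -
    let ?t = "\<lambda>i j. (E i - 1) / (\<rho> i - \<rho> j)"
    have cst: "(\<Sum>i\<in>R. \<Sum>j\<in>R - {i}. s * E i) = s * (real (card R) - 1) * (\<Sum>i\<in>R. E i)"
      using fR k by (simp add: sum_distrib_left sum_distrib_right of_nat_diff mult_ac)
    have "2 * (\<Sum>i\<in>R. \<Sum>j\<in>R - {i}. ?t i j) = (\<Sum>i\<in>R. \<Sum>j\<in>R - {i}. ?t i j + ?t j i)"
      using sum_offdiagonal_swap[OF fR, of ?t] by (simp add: sum.distrib)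
    also have "\<dots> \<le> (\<Sum>i\<in>R. \<Sum>j\<in>R - {i}. s * E i + s * E j)"
    proof (intro sum_mono)
      fix i j assume ij: "i \<in> R" "j \<in> R - {i}"
      have "?t i j + ?t j i = (E i - E j) / (\<rho> i - \<rho> j)"
        using ne[of i j] ij by (simp add: divide_simps) (simp add: algebra_simps)
      also have "\<dots> \<le> s * E i + s * E j"
        using exp_chord_le[OF s, of "\<rho> i" "\<rho> j"] ne[of i j] ij by (auto simp: E_def distrib_left)
      finally show "?t i j + ?t j i \<le> s * E i + s * E j" .
    qed
    also have "\<dots> = 2 * (s * (real (card R) - 1) * (\<Sum>i\<in>R. E i))"
      using sum_offdiagonal_swap[OF fR, of "\<lambda>i j. s * E i"] cst by (simp add: sum.distrib)
    finally show ?thesis by simp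
  qed
  \<comment> \<open>The equilibrium inequalities are summed with the nonnegative weights
    \<open>E i - 1\<close>.\<close>
  have "(b + 1) / 4 * ((\<Sum>i\<in>R. E i) - card R) = (\<Sum>i\<in>R. (E i - 1) * ((b + 1) / 4))"
    unfolding sum_distrib_right[symmetric] by (simp add: sum_subtractf mult.commute)
  also have "\<dots> \<le> (\<Sum>i\<in>R. (a + 1) * (s * E i) + \<beta> * (\<Sum>j\<in>R - {i}. (E i - 1) / (\<rho> i - \<rho> j)))"
  proof (intro sum_mono)
    fix i assume i: "i \<in> R"
    have "(E i - 1) * ((b + 1) / 4) \<le> (E i - 1) * ((a + 1) / \<rho> i + \<beta> * (\<Sum>j\<in>R - {i}. 1 / (\<rho> i - \<rho> j)))"
      using force[OF i] E1[OF i] by (intro mult_left_mono) auto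
    also have "\<dots> = (a + 1) * ((E i - 1) / \<rho> i) + \<beta> * (\<Sum>j\<in>R - {i}. (E i - 1) / (\<rho> i - \<rho> j))"
    proof -
      have "(E i - 1) * (\<Sum>j\<in>R - {i}. 1 / (\<rho> i - \<rho> j)) = (\<Sum>j\<in>R - {i}. (E i - 1) / (\<rho> i - \<rho> j))"
        by (simp add: sum_distrib_left)
      then show ?thesis unfolding distrib_left mult.left_commute[of "E i - 1" \<beta>] by simp
    qed
    also have "(E i - 1) / \<rho> i \<le> s * E i"
    proof -
      have "1 + (- (s * \<rho> i)) \<le> exp (- (s * \<rho> i))" by (rule exp_ge_add_one_self)
      then have "E i * (1 - s * \<rho> i) \<le> 1" using E1[OF i]
        by (simp add: E_def exp_minus field_simps)
      then show ?thesis using \<rho>[OF i] by (simp add: divide_le_eq algebra_simps)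
    qed
    finally show "(E i - 1) * ((b + 1) / 4) \<le> (a + 1) * (s * E i) + \<beta> * (\<Sum>j\<in>R - {i}. (E i - 1) / (\<rho> i - \<rho> j))"
      using ab by (simp add: mult_left_mono)
  qed
  also have "\<dots> = (a + 1) * s * (\<Sum>i\<in>R. E i) + \<beta> * (\<Sum>i\<in>R. \<Sum>j\<in>R - {i}. (E i - 1) / (\<rho> i - \<rho> j))"
    by (simp add: sum.distrib sum_distrib_left mult.assoc)
  also have "\<dots> \<le> (a + 1) * s * (\<Sum>i\<in>R. E i) + \<beta> * (s * (real (card R) - 1) * (\<Sum>i\<in>R. E i))"
    using pairs ab by (intro add_left_mono mult_left_mono) auto
  also have "\<dots> = (a + 1 + \<beta> * (real (card R) - 1)) * (s * (\<Sum>i\<in>R. E i))" by (simp add: algebra_simps)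
  \<comment> \<open>Hypothesis \<open>q\<close> bounds the prefactor by 2. The choice of
    \<open>s\<close> then makes this half of the leading term on the left, so the sum of
    \<open>E\<close> is at most twice the cardinality of \<open>R\<close>.\<close>
  also have "\<dots> \<le> 2 * (s * (\<Sum>i\<in>R. E i))"
    using q s E1 by (intro mult_right_mono mult_nonneg_nonneg sum_nonneg) force+
  also have "\<dots> = (b + 1) / 8 * (\<Sum>i\<in>R. E i)" by (simp add: s_def)
  finally have "(b + 1) * (\<Sum>i\<in>R. E i) \<le> (b + 1) * (2 * card R)" by (simp add: algebra_simps)
  then have "(\<Sum>i\<in>R. E i) \<le> 2 * card R" using ab by (subst (asm) mult_le_cancel_left_pos) auto
  moreover have "E j \<le> (\<Sum>i\<in>R. E i)" using fR j E1 by (intro member_le_sum) force+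
  ultimately have "E j \<le> 2 * card R" by linarith
  then have "s * \<rho> j \<le> ln (2 * card R)"
    using k by (subst exp_le_cancel_iff[symmetric], subst exp_ln) (auto simp: E_def)
  then show ?thesis using ab by (simp add: s_def \<rho>_def field_simps)
qed

section \<open>Choice of the fixed particles and of the parameters\<close>

lemma exists_top_subset:
  fixes y :: "nat \<Rightarrow> real"
  assumes "inj_on y {..<n}" "k \<le> n"
  shows "\<exists>R\<subseteq>{..<n}. card R = k \<and> (\<forall>i\<in>{..<n} - R. \<forall>j\<in>R. y i < y j)"
  using assms(2)
proof (induction k)
  case 0
  then show ?case by (intro exI[of _ "{}"]) auto
next
  case (Suc k)
  then obtain R where R: "R \<subseteq> {..<n}" "card R = k" "\<forall>i\<in>{..<n} - R. \<forall>j\<in>R. y i < y j" by auto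
  have fR: "finite R" using R(1) by (rule finite_subset) simp
  have ne: "{..<n} - R \<noteq> {}"
  proof
    assume "{..<n} - R = {}"
    then have "R = {..<n}" using R by auto
    then show False using R Suc by simp
  qed
  have fin: "finite ({..<n} - R)" by simp
  have "Max (y ` ({..<n} - R)) \<in> y ` ({..<n} - R)" using ne by (intro Max_in) auto
  then obtain m where m1: "m \<in> {..<n} - R" "y m = Max (y ` ({..<n} - R))" by force
  then have m: "m \<in> {..<n} - R" "\<And>i. i \<in> {..<n} - R \<Longrightarrow> y i \<le> y m" by auto
  show ?case
  proof (intro exI[of _ "insert m R"] conjI ballI)
    fix i j assume i: "i \<in> {..<n} - insert m R" and j: "j \<in> insert m R"
    show "y i < y j"
    proof (cases "j = m")
      case True
      have "y i \<le> y m" using m(2) i by auto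
      moreover have "y i \<noteq> y m" using assms(1) i m(1) by (auto simp: inj_on_def)
      ultimately show ?thesis using True by simp
    qed (use i j R in auto)
  qed (use m R fR in auto)
qed

lemma upper_chamber_tail:
  fixes y :: "nat \<Rightarrow> real" and a b \<beta> c :: real
  assumes n: "n \<ge> 2" and ab: "a > -1" "b > -1" "\<beta> > 0"
    and inj: "inj_on y {..<n}"
    and y: "\<And>i. i < n \<Longrightarrow> -2 < y i \<and> y i < 2"
    and st: "\<And>i. i < n \<Longrightarrow> \<beta> * (\<Sum>j\<in>{..<n} - {i}. 1 / (y i - y j)) = (a + 1) / (2 - y i) - (b + 1) / (2 + y i)"
    and large: "32 * ln n \<le> a + b"
    and c_def: "c = sqrt (512 * (ln n / (a + b)))"
    and fin: "(\<integral>\<^sup>+v. ennreal (jacobi_weight n a b \<beta> v) * indicator (chamber n y) v \<partial>PiM {..<n} (\<lambda>_. lborel)) < \<infinity>"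
  shows "(\<integral>\<^sup>+v. ennreal (jacobi_weight n a b \<beta> v) * indicator (chamber n y) v * indicator {v. \<exists>i<n. 2 * c \<le> v i - y i} v \<partial>PiM {..<n} (\<lambda>_. lborel))
     \<le> ennreal (8 / real n ^ 3) *
       (\<integral>\<^sup>+v. ennreal (jacobi_weight n a b \<beta> v) * indicator (chamber n y) v \<partial>PiM {..<n} (\<lambda>_. lborel))"
proof -
  define A where "A = a + b"
  define L where "L = ln n / A"
  have ln2: "ln n \<ge> (1/2 :: real)"
    using n exp_half_le2 by (subst ln_ge_iff) auto
  have A: "A \<ge> 16" "32 * ln n \<le> A" using large ln2 by (auto simp: A_def)
  have L: "0 < L" "L \<le> 1 / 32" "L * A = ln n" using A ln2 by (auto simp: L_def divide_simps)
  have c2: "c\<^sup>2 = 512 * L" and c: "c > 0" using L by (auto simp: c_def L_def A_def)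
  \<comment> \<open>One of \<open>a\<close> and \<open>b\<close> is at least A / 2, which is 32
    \<kappa>. Moreover \<kappa> c^2 / 2 becomes 4 ln n, which makes the hyperbolic cosine of order
    n^4.\<close>
  define \<kappa> where "\<kappa> = A / 64"
  have \<kappa>: "\<kappa> > 0" using A by (simp add: \<kappa>_def)
  have kc: "\<kappa> * c\<^sup>2 / 2 = 4 * ln n" using L(3) by (simp add: c2 \<kappa>_def mult.commute)
  \<comment> \<open>The fewest top particles whose repulsion raises the wall exponent to 1. The
    alternative k = n guarantees that a least \<open>k\<close> exists; in that case no particle
    moves.\<close>
  define P where "P k \<longleftrightarrow> k = n \<or> a + \<beta> * real k \<ge> 1" for k
  define k where "k = (LEAST k. P k)"
  have Pk: "P k" unfolding k_def by (rule LeastI[of P n]) (simp add: P_def)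
  have kn: "k \<le> n" unfolding k_def by (rule Least_le) (simp add: P_def)
  have kmin: "a + \<beta> * (real k - 1) \<le> 1" if "k > 0"
  proof -
    have "\<not> P (k - 1)" unfolding k_def by (rule not_less_Least) (use that in \<open>simp add: k_def\<close>)
    then show ?thesis using that by (simp add: P_def of_nat_diff)
  qed
  obtain R where R: "R \<subseteq> {..<n}" "card R = k" "\<forall>i\<in>{..<n} - R. \<forall>j\<in>R. y i < y j"
    using exists_top_subset[OF inj kn] by blast
  have fR: "finite R" using R(1) by (rule finite_subset) simp
  \<comment> \<open>The depth of the fixed targets given by \<open>edge_roots_bound\<close>, whose
    hypothesis on the cardinality is the minimality of \<open>k\<close>.\<close>
  define c0 where "c0 = (if R = {} then 0 else 16 * ln (2 * k) / (b + 1))"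
  have c0R: "2 - y j \<le> c0" if "j \<in> R" for j
  proof -
    have ne: "R \<noteq> {}" using that by auto
    then have k0: "k > 0" using R(2) fR by (metis card_gt_0_iff)
    have "2 - y j \<le> 16 * ln (2 * card R) / (b + 1)"
      by (rule edge_roots_bound[OF ab inj y R(1) _ ne st]) (use R that kmin[OF k0] in auto)
    then show ?thesis using ne R(2) by (simp add: c0_def)
  qed
  have c00: "c0 \<ge> 0"
    using R(2) fR ab by (cases "k = 0") (auto simp: c0_def intro!: divide_nonneg_nonneg)
  have q: "a + \<beta> * card R \<ge> 1" if "R \<noteq> {..<n}"
  proof -
    have "k \<noteq> n" using that R card_subset_eq[of "{..<n}" R] by auto
    then show ?thesis using Pk R(2) by (simp add: P_def)
  qed
  have cases: "2 * c0 \<le> c \<and> ((b \<ge> 32 * \<kappa> \<and> c\<^sup>2 * b \<ge> 32) \<or> (R = {} \<and> c0 = 0 \<and> a \<ge> 32 * \<kappa> \<and> a * c \<ge> 8))"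
  proof (cases "b \<ge> A / 2")
    case True
    have "2 * c0 \<le> c"
    proof (cases "R = {}")
      case False
      then have k0: "k > 0" using R(2) fR by (metis card_gt_0_iff)
      have "ln (2 * real k) \<le> ln (real n * real n)"
        using k0 kn n mult_mono[of 2 "real n" "real k" "real n"] by (intro ln_mono) auto
      also have "\<dots> = 2 * ln n" using n by (simp add: ln_mult)
      finally have "16 * ln (2 * real k) / (b + 1) \<le> 32 * ln n / (A / 2)"
        using True A ln2 by (intro frac_le) auto
      also have "\<dots> = 64 * L" by (simp add: L_def)
      finally have "2 * c0 \<le> 128 * L" using False by (simp add: c0_def)
      \<comment> \<open>Squared, this says 16384 L^2 \<le> 512 L, that is L \<le> 1 / 32: the
        largeness assumption on a + b.\<close>
      also have "\<dots> \<le> c"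
      proof (rule power2_le_imp_le)
        show "(128 * L)\<^sup>2 \<le> c\<^sup>2" using L mult_left_mono[of L "1/32" "16384 * L"]
          unfolding c2 by (simp add: power2_eq_square)
      qed (use c in simp)
      finally show ?thesis .
    qed (use c in \<open>simp add: c0_def\<close>)
    moreover have "32 \<le> c\<^sup>2 * b"
    proof -
      have "32 \<le> 256 * ln n" using ln2 by simp
      also have "\<dots> = c\<^sup>2 * (A / 2)" unfolding c2 L(3)[symmetric] by (simp add: power2_eq_square)
      also have "\<dots> \<le> c\<^sup>2 * b" using True by (intro mult_left_mono) auto
      finally show ?thesis .
    qed
    ultimately show ?thesis using True by (simp add: \<kappa>_def)
  next
    case False
    \<comment> \<open>Now the upper edge is strong enough by itself: the exponent \<open>a\<close>
      is at least 1, so no particle has to be left in place.\<close>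
    then have aA: "a \<ge> A / 2" by (simp add: A_def)
    have "P 0" using aA A by (simp add: P_def)
    then have "k = 0" unfolding k_def by (rule Least_eq_0)
    then have "R = {}" using R(2) fR by simp
    moreover have "8 \<le> a * c"
    proof (rule power2_le_imp_le)
      have "8\<^sup>2 \<le> 128 * (A * ln n)" using A ln2 mult_mono[of 16 A "1/2" "ln n"] by simp
      also have "\<dots> = (A / 2)\<^sup>2 * c\<^sup>2" unfolding c2 L(3)[symmetric] by (simp add: power2_eq_square)
      also have "\<dots> \<le> a\<^sup>2 * c\<^sup>2" using aA A by (intro mult_right_mono power_mono) auto
      finally show "8\<^sup>2 \<le> (a * c)\<^sup>2" by (simp add: power_mult_distrib)
    qed (use aA A c in simp)
    ultimately show ?thesis using aA c by (simp add: \<kappa>_def c0_def)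
  qed
  let ?Z = "(\<integral>\<^sup>+v. ennreal (jacobi_weight n a b \<beta> v) * indicator (chamber n y) v \<partial>PiM {..<n} (\<lambda>_. lborel))"
  have "(\<integral>\<^sup>+v. ennreal (jacobi_weight n a b \<beta> v) * indicator (chamber n y) v * indicator {v. \<exists>i<n. 2 * c \<le> v i - y i} v \<partial>PiM {..<n} (\<lambda>_. lborel))
    \<le> ennreal (2 * real n / (cosh (\<kappa> * c\<^sup>2 / 2) - 1)) * ?Z"
    by (rule upper_chamber_bound[OF ab inj y R(1) _ c0R st q c c00 _ \<kappa> _ fin]) (use R cases in auto)
  also have "\<dots> \<le> ennreal (8 / real n ^ 3) * ?Z"
  proof (intro mult_right_mono ennreal_leI)
    \<comment> \<open>The cosine is at least n^4 / 2, and n^4 \<ge> 16 lets half of that absorb the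
      subtracted 1.\<close>
    have n4: "real n ^ 4 \<ge> 16" using n power_mono[of 2 "real n" 4] by simp
    have "exp (4 * ln n) = real n ^ 4" using n by (simp add: exp_of_nat_mult[of 4, simplified])
    then have "cosh (\<kappa> * c\<^sup>2 / 2) - 1 \<ge> real n ^ 4 / 2 - 1"
      unfolding kc cosh_def by (simp add: add_divide_distrib)
    then have ge: "cosh (\<kappa> * c\<^sup>2 / 2) - 1 \<ge> real n ^ 4 / 4" using n4 by linarith
    have "2 * real n / (cosh (\<kappa> * c\<^sup>2 / 2) - 1) \<le> 2 * real n / (real n ^ 4 / 4)"
      using ge n4 n by (intro divide_left_mono mult_pos_pos) auto
    also have "\<dots> = 8 / real n ^ 3" using n by (simp add: field_simps eval_nat_numeral)
    finally show "2 * real n / (cosh (\<kappa> * c\<^sup>2 / 2) - 1) \<le> 8 / real n ^ 3" .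
  qed simp
  finally show ?thesis .
qed

section \<open>Two-sided deviations by reflection\<close>

lemma nn_integral_PiM_reflect:
  assumes [measurable]: "f \<in> borel_measurable (PiM I (\<lambda>_. lborel))" and "finite I"
  shows "(\<integral>\<^sup>+v. f v \<partial>PiM I (\<lambda>_. lborel :: real measure)) = (\<integral>\<^sup>+v. f (\<lambda>i\<in>I. - v i) \<partial>PiM I (\<lambda>_. lborel))"
  using nn_integral_PiM_lborel_substitution[of I "\<lambda>_. uminus" "\<lambda>_ _. 1" f] assms
  by (simp add: lborel_distr_uminus density_1)

lemma jacobi_weight_reflect: "jacobi_weight n a b \<beta> (\<lambda>i\<in>{..<n}. - v i) = jacobi_weight n b a \<beta> v"
proof -
  have "(\<Prod>i<n. \<Prod>j\<in>{i<..<n}. \<bar>(\<lambda>i\<in>{..<n}. - v i) i - (\<lambda>i\<in>{..<n}. - v i) j\<bar> powr \<beta>)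
      = (\<Prod>i<n. \<Prod>j\<in>{i<..<n}. \<bar>v i - v j\<bar> powr \<beta>)"
    by (intro prod.cong refl) (simp add: abs_minus_commute)
  moreover have "(\<Prod>i<n. (2 - (\<lambda>i\<in>{..<n}. - v i) i) powr a * (2 + (\<lambda>i\<in>{..<n}. - v i) i) powr b
        * indicator {-2<..<2} ((\<lambda>i\<in>{..<n}. - v i) i))
      = (\<Prod>i<n. (2 - v i) powr b * (2 + v i) powr a * indicator {-2<..<2} (v i))"
    by (intro prod.cong refl) (auto simp: indicator_def)
  ultimately show ?thesis by (simp only: jacobi_weight_def)
qed

lemma chamber_reflect: "(\<lambda>i\<in>{..<n}. - v i) \<in> chamber n y \<longleftrightarrow> v \<in> chamber n (\<lambda>i. - y i)"
  by (auto simp: chamber_def)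

text \<open>Negating all coordinates exchanges \<open>a\<close> with \<open>b\<close>, negates the
  targets and turns downward deviations into upward ones. The union bound doubles the constant
  8.\<close>

lemma chamber_tail:
  fixes y :: "nat \<Rightarrow> real" and a b \<beta> c :: real
  assumes n: "n \<ge> 2" and ab: "a > -1" "b > -1" "\<beta> > 0"
    and inj: "inj_on y {..<n}"
    and y: "\<And>i. i < n \<Longrightarrow> -2 < y i \<and> y i < 2"
    and st: "\<And>i. i < n \<Longrightarrow> \<beta> * (\<Sum>j\<in>{..<n} - {i}. 1 / (y i - y j)) = (a + 1) / (2 - y i) - (b + 1) / (2 + y i)"
    and large: "32 * ln n \<le> a + b"
    and c_def: "c = sqrt (512 * (ln n / (a + b)))"
    and fin: "(\<integral>\<^sup>+v. ennreal (jacobi_weight n a b \<beta> v) * indicator (chamber n y) v \<partial>PiM {..<n} (\<lambda>_. lborel)) < \<infinity>"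
  shows "(\<integral>\<^sup>+v. ennreal (jacobi_weight n a b \<beta> v) * indicator (chamber n y) v * indicator {v. \<exists>i<n. 2 * c \<le> \<bar>v i - y i\<bar>} v \<partial>PiM {..<n} (\<lambda>_. lborel))
     \<le> ennreal (16 / real n ^ 3) *
       (\<integral>\<^sup>+v. ennreal (jacobi_weight n a b \<beta> v) * indicator (chamber n y) v \<partial>PiM {..<n} (\<lambda>_. lborel))"
proof -
  let ?P = "PiM {..<n} (\<lambda>_. lborel :: real measure)"
  let ?y = "\<lambda>i. - y i"
  let ?U = "{v. \<exists>i<n. 2 * c \<le> v i - y i}" and ?D = "{v. \<exists>i<n. 2 * c \<le> y i - v i}"
  let ?U' = "{v. \<exists>i<n. 2 * c \<le> v i - ?y i}"
  let ?f = "\<lambda>v. ennreal (jacobi_weight n a b \<beta> v) * indicator (chamber n y) v :: ennreal"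
  let ?g = "\<lambda>v. ennreal (jacobi_weight n b a \<beta> v) * indicator (chamber n ?y) v :: ennreal"
  have pB: "Measurable.pred ?P (\<lambda>v. \<exists>i\<in>{..<n}. 2 * c \<le> v i - z i)" "Measurable.pred ?P (\<lambda>v. \<exists>i\<in>{..<n}. 2 * c \<le> z i - v i)" for z
    by (intro pred_intros_finite; measurable)+
  have [measurable]: "Measurable.pred ?P (\<lambda>v. v \<in> ?U)" "Measurable.pred ?P (\<lambda>v. v \<in> ?D)"
    using pB[of y] by (simp_all add: Bex_def)
  have ind: "(\<lambda>v. indicator B v :: ennreal) = (\<lambda>v. if v \<in> B then 1 else 0)" for B :: "(nat \<Rightarrow> real) set"
    by (auto simp: indicator_def)
  have fm[measurable]: "?f \<in> borel_measurable ?P" unfolding ind by measurable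
  have fU[measurable]: "(\<lambda>v. ?f v * indicator ?U v) \<in> borel_measurable ?P" unfolding ind by measurable
  have fD[measurable]: "(\<lambda>v. ?f v * indicator ?D v) \<in> borel_measurable ?P" unfolding ind by measurable
  have fg: "?f (\<lambda>i\<in>{..<n}. - v i) = ?g v" for v
    by (simp add: jacobi_weight_reflect chamber_reflect indicator_def)
  have Zeq: "(\<integral>\<^sup>+v. ?f v \<partial>?P) = (\<integral>\<^sup>+v. ?g v \<partial>?P)"
    by (subst nn_integral_PiM_reflect[OF fm]) (simp_all only: fg finite_lessThan)
  have "(\<integral>\<^sup>+v. ?f v * indicator ?D v \<partial>?P) = (\<integral>\<^sup>+v. ?f (\<lambda>i\<in>{..<n}. - v i) * indicator ?D (\<lambda>i\<in>{..<n}. - v i) \<partial>?P)"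
    by (rule nn_integral_PiM_reflect[OF fD]) simp
  also have "\<dots> = (\<integral>\<^sup>+v. ?g v * indicator ?U' v \<partial>?P)"
    unfolding fg by (intro nn_integral_cong arg_cong2[where f = "(*)"]) (auto simp: indicator_def add.commute)
  also have "\<dots> \<le> ennreal (8 / real n ^ 3) * (\<integral>\<^sup>+v. ?g v \<partial>?P)"
  proof (rule upper_chamber_tail[where y = ?y, OF n ab(2,1,3)])
    show "inj_on ?y {..<n}" using inj by (simp add: inj_on_def)
    show "32 * ln n \<le> b + a" "c = sqrt (512 * (ln n / (b + a)))" using large c_def by (simp_all add: add.commute)
    show "(\<integral>\<^sup>+v. ?g v \<partial>?P) < \<infinity>" using fin Zeq by simp
    fix i assume i: "i < n"
    show "-2 < ?y i \<and> ?y i < 2" using y[OF i] by auto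
    have "(\<Sum>j\<in>{..<n} - {i}. 1 / (?y i - ?y j)) = - (\<Sum>j\<in>{..<n} - {i}. 1 / (y i - y j))"
      unfolding sum_negf[symmetric] by (intro sum.cong) (auto simp: minus_divide_right)
    then show "\<beta> * (\<Sum>j\<in>{..<n} - {i}. 1 / (?y i - ?y j)) = (b + 1) / (2 - ?y i) - (a + 1) / (2 + ?y i)"
      using st[OF i] by simp
  qed
  finally have D: "(\<integral>\<^sup>+v. ?f v * indicator ?D v \<partial>?P) \<le> ennreal (8 / real n ^ 3) * (\<integral>\<^sup>+v. ?f v \<partial>?P)"
    unfolding Zeq .
  have U: "(\<integral>\<^sup>+v. ?f v * indicator ?U v \<partial>?P) \<le> ennreal (8 / real n ^ 3) * (\<integral>\<^sup>+v. ?f v \<partial>?P)"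
    by (rule upper_chamber_tail[OF n ab inj y st large c_def fin])
  have "(\<integral>\<^sup>+v. ?f v * indicator {v. \<exists>i<n. 2 * c \<le> \<bar>v i - y i\<bar>} v \<partial>?P)
    \<le> (\<integral>\<^sup>+v. ?f v * indicator ?U v + ?f v * indicator ?D v \<partial>?P)"
  proof (rule nn_integral_mono)
    fix v
    have "indicator {v. \<exists>i<n. 2 * c \<le> \<bar>v i - y i\<bar>} v \<le> (indicator ?U v + indicator ?D v :: ennreal)"
      by (auto simp: indicator_def abs_if split: if_splits)
    then show "?f v * indicator {v. \<exists>i<n. 2 * c \<le> \<bar>v i - y i\<bar>} v \<le> ?f v * indicator ?U v + ?f v * indicator ?D v"
      unfolding distrib_left[symmetric] by (rule mult_left_mono) simp
  qed
  also have "\<dots> = (\<integral>\<^sup>+v. ?f v * indicator ?U v \<partial>?P) + (\<integral>\<^sup>+v. ?f v * indicator ?D v \<partial>?P)"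
    by (rule nn_integral_add) simp_all
  also have "\<dots> \<le> ennreal (8 / real n ^ 3) * (\<integral>\<^sup>+v. ?f v \<partial>?P) + ennreal (8 / real n ^ 3) * (\<integral>\<^sup>+v. ?f v \<partial>?P)"
    by (intro add_mono U D)
  also have "\<dots> = ennreal (16 / real n ^ 3) * (\<integral>\<^sup>+v. ?f v \<partial>?P)"
    unfolding distrib_right[symmetric] by (simp add: ennreal_plus[symmetric] del: ennreal_plus)
  finally show ?thesis .
qed

section \<open>Deviations of the order statistics\<close>

text \<open>A sorted list is determined by its multiset, so every permutation that sorts the values
  computes the order statistics, even with ties.\<close>

lemma order_stat_eq:
  assumes q: "q permutes {..<n}" and s: "\<And>k l. k \<le> l \<Longrightarrow> l < n \<Longrightarrow> v (q k) \<le> v (q l)" and j: "j \<in> {1..n}"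
  shows "order_stat n v j = v (q (j - 1))"
proof -
  have "mset (map q [0..<n]) = mset [0..<n]"
  proof (rule set_eq_iff_mset_eq_distinct[THEN iffD1])
    show "distinct (map q [0..<n])" using permutes_inj[OF q] by (simp add: distinct_map inj_on_def)
    show "set (map q [0..<n]) = set [0..<n]" using permutes_image[OF q] by (simp add: lessThan_atLeast0)
  qed simp
  then have "mset (map v (map q [0..<n])) = mset (map v [0..<n])" by (simp only: mset_map)
  moreover have "sorted (map v (map q [0..<n]))" using s by (auto simp: sorted_iff_nth_mono)
  ultimately have "sort (map v [0..<n]) = map v (map q [0..<n])" by (intro properties_for_sort) auto
  moreover have "j - Suc 0 < n" using j by auto
  ultimately show ?thesis by (simp add: order_stat_def)
qed

lemma ex_sorting_permutation:
  fixes v :: "nat \<Rightarrow> real" and n :: nat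
  obtains q where "q permutes {..<n}" "\<And>k l. k \<le> l \<Longrightarrow> l < n \<Longrightarrow> v (q k) \<le> v (q l)"
proof -
  have "mset (sort (map v [0..<n])) = mset (map v [0..<n])" by simp
  from mset_eq_permutation[OF this] obtain q where
    q: "q permutes {..<n}" "permute_list q (map v [0..<n]) = sort (map v [0..<n])" by auto
  have lt: "q k < n" if "k < n" for k using permutes_in_image[OF q(1), of k] that by auto
  have nth: "sort (map v [0..<n]) ! k = v (q k)" if "k < n" for k
    using that lt[OF that] unfolding q(2)[symmetric] by (simp add: permute_list_def)
  have "v (q k) \<le> v (q l)" if "k \<le> l" "l < n" for k l
    using sorted_nth_mono[OF sorted_sort that(1), of "map v [0..<n]"] that nth[of k] nth[of l] by simp
  with q(1) show ?thesis by (rule that)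
qed

text \<open>A sublevel set is a finite union, over the candidate sorting permutations, of sets cut
  out by coordinate inequalities.\<close>

lemma order_stat_measurable:
  assumes j: "j \<in> {1..n}"
  shows "(\<lambda>v. order_stat n v j) \<in> borel_measurable (PiM {..<n} (\<lambda>_. lborel))"
proof (rule borel_measurableI_le)
  fix t :: real
  let ?P = "PiM {..<n} (\<lambda>_. lborel :: real measure)"
  have eq: "order_stat n v j \<le> t \<longleftrightarrow> (\<exists>q\<in>{q. q permutes {..<n}}. (\<forall>l\<in>{..<n}. \<forall>k\<in>{..l}. v (q k) \<le> v (q l)) \<and> v (q (j - 1)) \<le> t)" for v
  proof
    assume *: "order_stat n v j \<le> t"
    obtain q where q: "q permutes {..<n}" "\<And>k l. k \<le> l \<Longrightarrow> l < n \<Longrightarrow> v (q k) \<le> v (q l)"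
      using ex_sorting_permutation[of n v] by blast
    then show "\<exists>q\<in>{q. q permutes {..<n}}. (\<forall>l\<in>{..<n}. \<forall>k\<in>{..l}. v (q k) \<le> v (q l)) \<and> v (q (j - 1)) \<le> t"
      using order_stat_eq[of q n v j] j * by (intro bexI[of _ q]) auto
  next
    assume "\<exists>q\<in>{q. q permutes {..<n}}. (\<forall>l\<in>{..<n}. \<forall>k\<in>{..l}. v (q k) \<le> v (q l)) \<and> v (q (j - 1)) \<le> t"
    then obtain q where "q permutes {..<n}" "\<forall>l\<in>{..<n}. \<forall>k\<in>{..l}. v (q k) \<le> v (q l)" "v (q (j - 1)) \<le> t" by auto
    then show "order_stat n v j \<le> t" using order_stat_eq[of q n v j] j by auto
  qed
  have m: "(\<lambda>v. v (q k)) \<in> borel_measurable ?P" if "q permutes {..<n}" "k < n" for q k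
    using permutes_in_image[OF that(1), of k] that(2) measurable_component_singleton[of "q k" "{..<n}" "\<lambda>_. lborel"]
    by simp
  have "Measurable.pred ?P (\<lambda>v. \<exists>q\<in>{q. q permutes {..<n}}. (\<forall>l\<in>{..<n}. \<forall>k\<in>{..l}. v (q k) \<le> v (q l)) \<and> v (q (j - 1)) \<le> t)"
  proof (intro pred_intros_finite pred_intros_logic)
    show "finite {q. q permutes {..<n}}" by (simp add: finite_permutations)
  next
    fix q l k assume "q \<in> {q. q permutes {..<n}}" "l \<in> {..<n}" "k \<in> {..l}"
    then show "Measurable.pred ?P (\<lambda>v. v (q k) \<le> v (q l))"
      unfolding pred_def by (intro borel_measurable_le m) auto
  next
    fix q assume "q \<in> {q. q permutes {..<n}}"
    then show "Measurable.pred ?P (\<lambda>v. v (q (j - 1)) \<le> t)"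
      unfolding pred_def using j by (intro borel_measurable_le m borel_measurable_const) auto
  qed auto
  then show "{v \<in> space ?P. order_stat n v j \<le> t} \<in> sets ?P" unfolding eq by (simp add: pred_def)
qed

text \<open>The value \<open>q i\<close> is the number of \<open>j\<close> with
  \<open>q j < q i\<close>, so the comparisons determine the permutation.\<close>

lemma strict_mono_permutes_unique:
  assumes p: "p permutes {..<n}" "p' permutes {..<n}"
    and iff: "\<And>i j. i < n \<Longrightarrow> j < n \<Longrightarrow> p i < p j \<longleftrightarrow> p' i < p' j"
  shows "p = (p' :: nat \<Rightarrow> nat)"
proof
  fix i
  have card: "card {j\<in>{..<n}. q j < q i} = q i" if q: "q permutes {..<n}" and i: "i < n" for q
  proof -
    have qi: "q i < n" using permutes_in_image[OF q, of i] i by auto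
    have "q ` {j\<in>{..<n}. q j < q i} = {..<q i}"
    proof
      show "{..<q i} \<subseteq> q ` {j\<in>{..<n}. q j < q i}"
      proof
        fix t assume t: "t \<in> {..<q i}"
        then have "t \<in> q ` {..<n}" using permutes_image[OF q] qi by auto
        then show "t \<in> q ` {j\<in>{..<n}. q j < q i}" using t by auto
      qed
    qed auto
    moreover have "card (q ` {j\<in>{..<n}. q j < q i}) = card {j\<in>{..<n}. q j < q i}"
      using permutes_inj[OF q] by (intro card_image) (auto simp: inj_on_def)
    ultimately show ?thesis by simp
  qed
  show "p i = p' i"
  proof (cases "i < n")
    case True
    have "{j\<in>{..<n}. p j < p i} = {j\<in>{..<n}. p' j < p' i}" using iff True by auto
    then show ?thesis using card[OF p(1) True] card[OF p(2) True] by simp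
  next
    case False
    then show ?thesis using p by (simp add: permutes_def)
  qed
qed

text \<open>The shift by \<open>Suc\<close> passes from ranks starting at 1 to indices starting at
  0. With these Jacobi parameters and the dilation by 2, Stieltjes' relation becomes the equilibrium
  of charges with exponents \<open>a + 1\<close> and \<open>b + 1\<close>.\<close>

lemma jacobi_nodes:
  fixes a b \<beta> :: real and n :: nat
  assumes ab: "a > -1" "b > -1" "\<beta> > 0"
  defines "x \<equiv> \<lambda>i. ordered_root_half (jacobiP n ((2 * a + 2) / \<beta> - 1) ((2 * b + 2) / \<beta> - 1)) (Suc i)"
  shows "\<And>i j. i < j \<Longrightarrow> j < n \<Longrightarrow> x i < x j"
    and "\<And>i. i < n \<Longrightarrow> -2 < x i \<and> x i < 2"
    and "\<And>i. i < n \<Longrightarrow> \<beta> * (\<Sum>j\<in>{..<n} - {i}. 1 / (x i - x j)) = (a + 1) / (2 - x i) - (b + 1) / (2 + x i)"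
proof -
  define \<gamma> where "\<gamma> = (2 * a + 2) / \<beta> - 1"
  define \<delta> where "\<delta> = (2 * b + 2) / \<beta> - 1"
  have gd: "\<gamma> > -1" "\<delta> > -1" using ab by (auto simp: \<gamma>_def \<delta>_def)
  let ?p = "jacobiP n \<gamma> \<delta>"
  define R where "R = {x. poly ?p x = 0}"
  define X where "X = {x. poly ?p (x / 2) = 0}"
  have R: "card R = n" "R \<subseteq> {-1<..<1}" "finite R"
    using jacobiP_roots[OF gd, of n] poly_roots_finite[OF jacobiP_properties(2)[OF gd]] by (auto simp: R_def)
  have XR: "X = (\<lambda>r. 2 * r) ` R"
  proof (intro equalityI subsetI)
    fix x assume "x \<in> X" then show "x \<in> (\<lambda>r. 2 * r) ` R" by (intro image_eqI[of _ _ "x / 2"]) (auto simp: X_def R_def)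
  qed (auto simp: X_def R_def)
  have X: "finite X" "card X = n" "X \<subseteq> {-2<..<2}"
    using R unfolding XR by (auto simp: card_image inj_on_def)
  define xs where "xs = sorted_list_of_set X"
  have xs: "length xs = n" "set xs = X" "sorted_wrt (<) xs" "distinct xs"
    using X unfolding xs_def by (auto simp: strict_sorted_iff)
  have x: "x i = xs ! i" for i
    by (simp add: x_def ordered_root_half_def xs_def X_def \<gamma>_def \<delta>_def)
  show "x i < x j" if "i < j" "j < n" for i j
    using sorted_wrt_nth_less[OF xs(3) that(1)] that xs(1) by (simp add: x)
  have xX: "x i \<in> X" if "i < n" for i using that xs nth_mem[of i xs] by (simp add: x)
  then show "-2 < x i \<and> x i < 2" if "i < n" for i using that X(3) by force
  have bij: "bij_betw x {..<n} X"
  proof -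
    have "x = (!) xs" by (rule ext) (rule x)
    then show ?thesis using bij_betw_nth[OF xs(4), of "{..<n}" X] xs by simp
  qed
  fix i assume i: "i < n"
  have xi: "x i \<in> X" "-2 < x i" "x i < 2" using xX[OF i] X(3) by auto
  have "(\<Sum>j\<in>{..<n} - {i}. 1 / (x i - x j)) = (\<Sum>s\<in>X - {x i}. 1 / (x i - s))"
    by (rule sum.reindex_bij_betw[OF bij_betw_subset[OF bij], of _ _ "\<lambda>s. 1 / (x i - s)"])
       (use bij i in \<open>auto simp: bij_betw_def inj_on_def image_iff\<close>)
  also have "X - {x i} = (\<lambda>r. 2 * r) ` (R - {x i / 2})" unfolding XR by auto
  also have "(\<Sum>s\<in>(\<lambda>r. 2 * r) ` (R - {x i / 2}). 1 / (x i - s)) = (\<Sum>r\<in>R - {x i / 2}. 1 / (x i - 2 * r))"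
    by (subst sum.reindex) (auto simp: inj_on_def)
  also have "\<dots> = (\<Sum>r\<in>R - {x i / 2}. 1 / (x i / 2 - r)) / 2"
    unfolding sum_divide_distrib by (intro sum.cong refl) (simp add: field_simps)
  also have "\<dots> = ((\<gamma> + 1) / (1 - x i / 2) - (\<delta> + 1) / (1 + x i / 2)) / 2 / 2"
    unfolding R_def by (subst jacobiP_stieltjes[OF gd]) (use xi in \<open>auto simp: X_def\<close>)
  also have "\<dots> = ((a + 1) / (2 - x i) - (b + 1) / (2 + x i)) / \<beta>"
  proof -
    have e: "1 - x i / 2 = (2 - x i) / 2" "1 + x i / 2 = (2 + x i) / 2"
      "\<gamma> + 1 = 2 * (a + 1) / \<beta>" "\<delta> + 1 = 2 * (b + 1) / \<beta>"
      by (simp_all add: \<gamma>_def \<delta>_def field_simps)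
    have gen: "(2 * A / \<beta> / (p / 2) - 2 * B / \<beta> / (q / 2)) / 2 / 2 = (A / p - B / q) / \<beta>"
      if "p > 0" "q > 0" for A B p q
      using that ab by (simp add: field_simps)
    show ?thesis unfolding e by (rule gen) (use xi in auto)
  qed
  finally show "\<beta> * (\<Sum>j\<in>{..<n} - {i}. 1 / (x i - x j)) = (a + 1) / (2 - x i) - (b + 1) / (2 + x i)"
    using ab by simp
qed

section \<open>Probability of a deviation\<close>

definition deviation :: "nat \<Rightarrow> real \<Rightarrow> real \<Rightarrow> real \<Rightarrow> (nat \<Rightarrow> real) \<Rightarrow> real" where
  "deviation n a b \<beta> v = Max ((\<lambda>j. \<bar>order_stat n v j -
     ordered_root_half (jacobiP n ((2 * a + 2) / \<beta> - 1) ((2 * b + 2) / \<beta> - 1)) j\<bar>) ` {1..n})"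

lemma deviation_measurable:
  assumes "n \<ge> 1"
  shows "deviation n a b \<beta> \<in> borel_measurable (PiM {..<n} (\<lambda>_. lborel))"
  unfolding deviation_def using assms
  by (intro borel_measurable_Max borel_measurable_abs borel_measurable_diff order_stat_measurable borel_measurable_const) auto

text \<open>A vanishing gap contributes the factor \<open>0 powr \<beta>\<close>, which is 0. Tied
  configurations thus drop out pointwise, and each remaining one lies in a chamber.\<close>

lemma jacobi_weight_zero_of_tie:
  assumes "i < n" "j < n" "i \<noteq> j" "v i = v j"
  shows "jacobi_weight n a b \<beta> v = 0"
proof -
  define k where "k = min i j"
  define l where "l = max i j"
  have kl: "k < n" "l \<in> {k<..<n}" "v k = v l" using assms by (auto simp: k_def l_def min_def max_def)
  then have "(\<Prod>j\<in>{k<..<n}. \<bar>v k - v j\<bar> powr \<beta>) = 0" by (intro prod_zero) auto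
  then have "(\<Prod>i<n. \<Prod>j\<in>{i<..<n}. \<bar>v i - v j\<bar> powr \<beta>) = 0" using kl(1) by (intro prod_zero) auto
  then show ?thesis by (simp add: jacobi_weight_def)
qed

text \<open>The permutations of the targets index disjoint chambers covering all configurations of
  nonzero weight. The tail bound is relative to the mass of each chamber, so summing it loses no
  factor for the number of chambers.\<close>

lemma deviation_probability:
  fixes a b \<beta> c :: real and n :: nat
  assumes M: "prob_space M" and n: "n \<ge> 2" and ab: "a > -1" "b > -1" "\<beta> > 0"
    and L: "distributed M (PiM {..<n} (\<lambda>_. lborel)) L (jacobi_density n a b \<beta>)"
    and large: "32 * ln n \<le> a + b"
    and c_def: "c = sqrt (512 * (ln n / (a + b)))"
  shows "measure M {\<omega>\<in>space M. 2 * c \<le> deviation n a b \<beta> (L \<omega>)} \<le> 16 / real n ^ 3"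
proof -
  interpret prob_space M by fact
  let ?P = "PiM {..<n} (\<lambda>_. lborel :: real measure)"
  define x where "x = (\<lambda>i. ordered_root_half (jacobiP n ((2 * a + 2) / \<beta> - 1) ((2 * b + 2) / \<beta> - 1)) (Suc i))"
  have xmono: "x i < x j" if "i < j" "j < n" for i j unfolding x_def using that by (rule jacobi_nodes(1)[OF ab])
  have xb: "-2 < x i \<and> x i < 2" if "i < n" for i unfolding x_def using that by (rule jacobi_nodes(2)[OF ab])
  have xst: "\<beta> * (\<Sum>j\<in>{..<n} - {i}. 1 / (x i - x j)) = (a + 1) / (2 - x i) - (b + 1) / (2 + x i)" if "i < n" for i
    unfolding x_def using that by (rule jacobi_nodes(3)[OF ab])
  have xless: "x i < x j \<longleftrightarrow> i < j" if "i < n" "j < n" for i j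
    using xmono[of i j] xmono[of j i] that by (cases i j rule: linorder_cases) auto
  define Perm where "Perm = {p. p permutes {..<n}}"
  have finPerm: "finite Perm" by (simp add: Perm_def finite_permutations)
  have pin: "p i < n" if "p \<in> Perm" "i < n" for p i using permutes_in_image[of p "{..<n}" i] that by (auto simp: Perm_def)
  let ?w = "\<lambda>v. ennreal (jacobi_weight n a b \<beta> v)"
  define C where "C p = chamber n (\<lambda>i. x (p i))" for p
  define B where "B p = {v. \<exists>i<n. 2 * c \<le> \<bar>v i - x (p i)\<bar>}" for p
  define Bad where "Bad = {v. 2 * c \<le> deviation n a b \<beta> v}"
  define Z where "Z = (\<integral>\<^sup>+v. ?w v \<partial>?P)"
  have Cp: "v i < v j \<longleftrightarrow> p i < p j" if "p \<in> Perm" "v \<in> C p" "i < n" "j < n" for p v i j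
  proof -
    have inj: "inj p" using that(1) permutes_inj by (auto simp: Perm_def)
    have "p i < p j \<Longrightarrow> v i < v j" "p j < p i \<Longrightarrow> v j < v i"
      using that xless pin by (auto simp: C_def chamber_def)
    then show ?thesis using inj by (cases "p i" "p j" rule: linorder_cases) (auto simp: inj_eq)
  qed
  have Bad_le: "?w v * indicator Bad v \<le> (\<Sum>p\<in>Perm. ?w v * indicator (C p) v * indicator (B p) v)" for v
  proof (cases "v \<in> Bad \<and> jacobi_weight n a b \<beta> v \<noteq> 0")
    case True
    obtain q where q: "q permutes {..<n}" "\<And>k l. k \<le> l \<Longrightarrow> l < n \<Longrightarrow> v (q k) \<le> v (q l)"
      using ex_sorting_permutation[of n v] by blast
    \<comment> \<open>While \<open>q\<close> lists the particles in increasing order, its inverse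
      gives the rank of a particle, hence the target assigned to it.\<close>
    define p where "p = inv q"
    have p: "p \<in> Perm" using permutes_inv[OF q(1)] by (simp add: p_def Perm_def)
    have pq: "p (q k) = k" "q (p k) = k" for k
      using permutes_inverses[OF q(1)] by (simp_all add: p_def)
    have "v \<in> C p" unfolding C_def chamber_def
    proof (intro CollectI allI impI)
      fix i j assume ij: "i < n" "j < n" "x (p i) < x (p j)"
      then have "p i < p j" using xless pin p by auto
      then have "v i \<le> v j" using q(2)[of "p i" "p j"] pin[OF p ij(2)] pq by simp
      moreover have "v i \<noteq> v j" using jacobi_weight_zero_of_tie[of i n j v a b \<beta>] True ij by auto
      ultimately show "v i < v j" by simp
    qed
    moreover have "v \<in> B p"
    proof -
      have "2 * c \<le> deviation n a b \<beta> v" using True by (simp add: Bad_def)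
      then obtain j where j: "j \<in> {1..n}" "2 * c \<le> \<bar>order_stat n v j -
          ordered_root_half (jacobiP n ((2 * a + 2) / \<beta> - 1) ((2 * b + 2) / \<beta> - 1)) j\<bar>"
        unfolding deviation_def using n by (subst (asm) Max_ge_iff) auto
      have "ordered_root_half (jacobiP n ((2 * a + 2) / \<beta> - 1) ((2 * b + 2) / \<beta> - 1)) j = x (p (q (j - 1)))"
        using j(1) by (simp add: x_def pq)
      moreover have "q (j - 1) < n" using permutes_in_image[OF q(1), of "j - 1"] j(1) by auto
      ultimately show ?thesis using j order_stat_eq[of q n v j] q by (auto simp: B_def)
    qed
    ultimately have "?w v * indicator Bad v = ?w v * indicator (C p) v * indicator (B p) v" using True by simp
    also have "\<dots> \<le> (\<Sum>p\<in>Perm. ?w v * indicator (C p) v * indicator (B p) v)"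
      using finPerm p by (intro member_le_sum) auto
    finally show ?thesis .
  qed auto
  \<comment> \<open>Chambers of different permutations are disjoint, since the order of the
    coordinates determines the ranks.\<close>
  have C_le: "(\<Sum>p\<in>Perm. ?w v * indicator (C p) v) \<le> ?w v" for v
  proof (cases "\<exists>p\<in>Perm. v \<in> C p")
    case True
    then obtain p where p: "p \<in> Perm" "v \<in> C p" by auto
    have uniq: "p' = p" if "p' \<in> Perm" "v \<in> C p'" for p'
      by (rule strict_mono_permutes_unique[of _ n]) (use Cp[of p' v] Cp[of p v] p that in \<open>auto simp: Perm_def\<close>)
    have "(\<Sum>p\<in>Perm. ?w v * indicator (C p) v) = (\<Sum>p\<in>{p}. ?w v * indicator (C p) v)"
    proof (rule sum.mono_neutral_right[OF finPerm])
      show "\<forall>p'\<in>Perm - {p}. ?w v * indicator (C p') v = 0"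
      proof
        fix p' assume "p' \<in> Perm - {p}"
        then have "v \<notin> C p'" using uniq by blast
        then show "?w v * indicator (C p') v = 0" by simp
      qed
    qed (use p(1) in simp)
    then show ?thesis using p by simp
  next
    case False
    then have "(\<Sum>p\<in>Perm. ?w v * indicator (C p) v) = 0" by (intro sum.neutral) auto
    then show ?thesis by simp
  qed
  have [measurable]: "deviation n a b \<beta> \<in> borel_measurable ?P" using n by (intro deviation_measurable) simp
  have Bad_pred[measurable]: "Measurable.pred ?P (\<lambda>v. v \<in> Bad)" unfolding Bad_def mem_Collect_eq by measurable
  have [measurable]: "Measurable.pred ?P (\<lambda>v. v \<in> C p)" for p unfolding C_def by measurable
  have "Measurable.pred ?P (\<lambda>v. \<exists>i\<in>{..<n}. 2 * c \<le> \<bar>v i - x (p i)\<bar>)" for p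
    by (intro pred_intros_finite) measurable
  then have [measurable]: "Measurable.pred ?P (\<lambda>v. v \<in> B p)" for p by (simp add: B_def Bex_def)
  have ind: "(\<lambda>v. indicator X v :: ennreal) = (\<lambda>v. if v \<in> X then 1 else 0)" for X :: "(nat \<Rightarrow> real) set"
    by (auto simp: indicator_def)
  have mC[measurable]: "(\<lambda>v. ?w v * indicator (C p) v) \<in> borel_measurable ?P" for p unfolding ind by measurable
  have mCB[measurable]: "(\<lambda>v. ?w v * indicator (C p) v * indicator (B p) v) \<in> borel_measurable ?P" for p unfolding ind by measurable
  have mBad[measurable]: "(\<lambda>v. ?w v * indicator Bad v) \<in> borel_measurable ?P" unfolding ind by measurable
  have em: "emeasure M (L -` A \<inter> space M) = (\<integral>\<^sup>+v. ?w v * indicator A v \<partial>?P) / Z"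
    if A: "A \<in> sets ?P" "(\<lambda>v. ?w v * indicator A v) \<in> borel_measurable ?P" for A
    unfolding distributed_emeasure[OF L A(1)] jacobi_density_def Z_def[symmetric] nn_integral_divide[OF A(2), symmetric]
    by (simp add: divide_ennreal_def mult_ac)
  have "emeasure M (L -` space ?P \<inter> space M) = 1"
    using measurable_space[OF distributed_measurable[OF L]] emeasure_space_1 by (subst Int_absorb1) auto
  moreover have "(\<integral>\<^sup>+v. ?w v * indicator (space ?P) v \<partial>?P) = Z"
    unfolding Z_def by (intro nn_integral_cong) simp
  \<comment> \<open>Total probability 1 forces Z / Z = 1, which in extended arithmetic excludes both
    \<open>Z = 0\<close> and \<open>Z = \<infinity>\<close>. The normalising integral is thus finite
    as a consequence of the existence of the random vector.\<close>
  ultimately have ZZ: "Z / Z = 1" using em[of "space ?P"] by simp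
  have Z: "Z < \<infinity>" "Z \<noteq> 0"
  proof -
    show "Z < \<infinity>"
    proof (rule ccontr)
      assume "\<not> Z < \<infinity>"
      then have "Z = \<infinity>" by (simp add: less_top[symmetric])
      then show False using ZZ by (simp add: divide_ennreal_def)
    qed
    show "Z \<noteq> 0" using ZZ by (auto simp: divide_ennreal_def)
  qed
  have tail: "(\<integral>\<^sup>+v. ?w v * indicator (C p) v * indicator (B p) v \<partial>?P) \<le> ennreal (16 / real n ^ 3) * (\<integral>\<^sup>+v. ?w v * indicator (C p) v \<partial>?P)"
    if p: "p \<in> Perm" for p
    unfolding C_def B_def
  proof (rule chamber_tail[OF n ab])
    have pp: "p permutes {..<n}" using p by (simp add: Perm_def)
    show "inj_on (\<lambda>i. x (p i)) {..<n}"
    proof (rule inj_onI)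
      fix i j assume ij: "i \<in> {..<n}" "j \<in> {..<n}" "x (p i) = x (p j)"
      then have "p i = p j" using xless[of "p i" "p j"] xless[of "p j" "p i"] pin[OF p] by force
      then show "i = j" using permutes_inj[OF pp] by (simp add: inj_eq)
    qed
    show "-2 < x (p i) \<and> x (p i) < 2" if "i < n" for i using xb pin[OF p that] by blast
    show "\<beta> * (\<Sum>j\<in>{..<n} - {i}. 1 / (x (p i) - x (p j))) = (a + 1) / (2 - x (p i)) - (b + 1) / (2 + x (p i))" if i: "i < n" for i
    proof -
      have "bij_betw p ({..<n} - {i}) ({..<n} - {p i})"
        using permutes_imp_bij[OF pp] i by (intro bij_betw_DiffI) (auto simp: bij_betw_def)
      then have "(\<Sum>j\<in>{..<n} - {i}. 1 / (x (p i) - x (p j))) = (\<Sum>k\<in>{..<n} - {p i}. 1 / (x (p i) - x k))"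
        by (rule sum.reindex_bij_betw)
      then show ?thesis using xst pin[OF p i] by simp
    qed
    show "32 * ln n \<le> a + b" "c = sqrt (512 * (ln n / (a + b)))" by fact+
    have "(\<integral>\<^sup>+v. ?w v * indicator (C p) v \<partial>?P) \<le> Z" unfolding Z_def by (intro nn_integral_mono) (simp add: indicator_def)
    then show "(\<integral>\<^sup>+v. ?w v * indicator (chamber n (\<lambda>i. x (p i))) v \<partial>?P) < \<infinity>"
      using Z(1) unfolding C_def by (rule le_less_trans)
  qed
  have "(\<integral>\<^sup>+v. ?w v * indicator Bad v \<partial>?P) \<le> (\<integral>\<^sup>+v. (\<Sum>p\<in>Perm. ?w v * indicator (C p) v * indicator (B p) v) \<partial>?P)"
    by (intro nn_integral_mono Bad_le)
  also have "\<dots> = (\<Sum>p\<in>Perm. \<integral>\<^sup>+v. ?w v * indicator (C p) v * indicator (B p) v \<partial>?P)"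
    by (rule nn_integral_sum) simp
  also have "\<dots> \<le> (\<Sum>p\<in>Perm. ennreal (16 / real n ^ 3) * (\<integral>\<^sup>+v. ?w v * indicator (C p) v \<partial>?P))"
    by (intro sum_mono tail)
  also have "\<dots> = ennreal (16 / real n ^ 3) * (\<integral>\<^sup>+v. (\<Sum>p\<in>Perm. ?w v * indicator (C p) v) \<partial>?P)"
    by (simp add: sum_distrib_left nn_integral_sum)
  also have "\<dots> \<le> ennreal (16 / real n ^ 3) * Z"
    unfolding Z_def by (intro mult_left_mono nn_integral_mono C_le) simp
  finally have I: "(\<integral>\<^sup>+v. ?w v * indicator Bad v \<partial>?P) \<le> ennreal (16 / real n ^ 3) * Z" .
  have "Bad \<inter> space ?P = {v \<in> space ?P. v \<in> Bad}" by auto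
  also have "\<dots> \<in> sets ?P" using Bad_pred unfolding pred_def .
  finally have "Bad \<inter> space ?P \<in> sets ?P" .
  moreover have eq: "?w v * indicator (Bad \<inter> space ?P) v = ?w v * indicator Bad v" if "v \<in> space ?P" for v
    using that by (simp add: indicator_def)
  ultimately have "emeasure M (L -` (Bad \<inter> space ?P) \<inter> space M) = (\<integral>\<^sup>+v. ?w v * indicator (Bad \<inter> space ?P) v \<partial>?P) / Z"
    using mBad by (intro em) (auto simp: measurable_cong[OF eq])
  also have "(\<integral>\<^sup>+v. ?w v * indicator (Bad \<inter> space ?P) v \<partial>?P) = (\<integral>\<^sup>+v. ?w v * indicator Bad v \<partial>?P)"
    by (rule nn_integral_cong) (rule eq)
  also have "\<dots> / Z \<le> ennreal (16 / real n ^ 3) * Z / Z" by (rule divide_right_mono_ennreal[OF I])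
  also have "\<dots> = ennreal (16 / real n ^ 3)" using ZZ by (simp add: ennreal_times_divide[symmetric])
  also have "L -` (Bad \<inter> space ?P) \<inter> space M = {\<omega>\<in>space M. 2 * c \<le> deviation n a b \<beta> (L \<omega>)}"
    using measurable_space[OF distributed_measurable[OF L]] by (auto simp: Bad_def)
  finally have "emeasure M {\<omega>\<in>space M. 2 * c \<le> deviation n a b \<beta> (L \<omega>)} \<le> ennreal (16 / real n ^ 3)" .
  then show ?thesis by (simp add: emeasure_eq_measure)
qed

text \<open>The supremum of the ratios D / r dominates by construction. It is almost surely finite
  because all but finitely many ratios are at most \<open>K\<close>.\<close>

lemma ex_dominating_random_variable:
  fixes D :: "nat \<Rightarrow> 'w \<Rightarrow> real" and r :: "nat \<Rightarrow> real"
  assumes D[measurable]: "\<And>n. n \<in> I \<Longrightarrow> D n \<in> borel_measurable M"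
    and r: "\<And>n. n \<in> I \<Longrightarrow> r n > 0"
    and ev: "AE \<omega> in M. eventually (\<lambda>n. n \<in> I \<longrightarrow> D n \<omega> \<le> K * r n) sequentially"
  shows "\<exists>S :: 'w \<Rightarrow> ereal. S \<in> borel_measurable M \<and> (AE \<omega> in M. S \<omega> < \<infinity>) \<and>
    (\<forall>\<omega>\<in>space M. \<forall>n\<in>I. ereal (D n \<omega>) \<le> ereal (r n) * S \<omega>)"
proof -
  define S where "S \<omega> = (SUP n\<in>I. ereal (D n \<omega> / r n))" for \<omega>
  have "S \<in> borel_measurable M" unfolding S_def
  proof (rule borel_measurable_SUP)
    show "countable I" by simp
    fix n assume "n \<in> I"
    then have [measurable]: "D n \<in> borel_measurable M" by (rule D)
    show "(\<lambda>\<omega>. ereal (D n \<omega> / r n)) \<in> borel_measurable M" by measurable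
  qed
  moreover have "AE \<omega> in M. S \<omega> < \<infinity>"
    using ev
  proof eventually_elim
    case (elim \<omega>)
    then obtain N where N: "\<And>n. n \<ge> N \<Longrightarrow> n \<in> I \<Longrightarrow> D n \<omega> \<le> K * r n" by (auto simp: eventually_sequentially)
    \<comment> \<open>The inserted 0 keeps the maximum over a nonempty set when N = 0.\<close>
    define T where "T = max K (Max (insert 0 ((\<lambda>n. D n \<omega> / r n) ` {..<N})))"
    have "S \<omega> \<le> ereal T" unfolding S_def
    proof (rule SUP_least)
      fix n assume n: "n \<in> I"
      have "D n \<omega> / r n \<le> T"
      proof (cases "n < N")
        case True
        then have "D n \<omega> / r n \<le> Max (insert 0 ((\<lambda>n. D n \<omega> / r n) ` {..<N}))" by (intro Max_ge) auto
        then show ?thesis by (simp add: T_def)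
      next
        case False
        then have "D n \<omega> / r n \<le> K" using N[of n] n r[OF n] by (simp add: divide_le_eq)
        then show ?thesis by (simp add: T_def)
      qed
      then show "ereal (D n \<omega> / r n) \<le> ereal T" by simp
    qed
    then show ?case by (rule le_less_trans) simp
  qed
  moreover have "ereal (D n \<omega>) \<le> ereal (r n) * S \<omega>" if "n \<in> I" for n \<omega>
  proof -
    have "ereal (D n \<omega>) = ereal (r n) * ereal (D n \<omega> / r n)" using r[OF that] by simp
    also have "\<dots> \<le> ereal (r n) * S \<omega>"
      unfolding S_def using r[OF that] that by (intro ereal_mult_left_mono SUP_upper) auto
    finally show ?thesis .
  qed
  ultimately show ?thesis by blast
qed

text \<open>The probabilities are bounded by 16 / n^3, which is summable, so Borel-Cantelli excludes
  infinitely many deviations of size \<open>2 * c n\<close>.\<close>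

lemma deviation_eventually_le:
  fixes M :: "'w measure"
    and a b \<beta> :: "nat \<Rightarrow> real"
    and \<Lambda> :: "nat \<Rightarrow> 'w \<Rightarrow> nat \<Rightarrow> real"
  assumes "prob_space M"
    and ab: "\<And>n. n \<ge> 2 \<Longrightarrow> a n > -1 \<and> b n > -1 \<and> \<beta> n > 0"
    and L: "\<And>n. n \<ge> 2 \<Longrightarrow>
           distributed M (PiM {..<n} (\<lambda>_. lborel)) (\<Lambda> n) (jacobi_density n (a n) (b n) (\<beta> n))"
    and lim: "filterlim (\<lambda>n. (a n + b n) / ln (real n)) at_top sequentially"
  shows "AE \<omega> in M. eventually (\<lambda>n. deviation n (a n) (b n) (\<beta> n) (\<Lambda> n \<omega>) \<le> 46 * (ln (real n) / (a n + b n)) powr (1/4)) sequentially"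
proof -
  interpret prob_space M by fact
  have "eventually (\<lambda>n. 32 \<le> (a n + b n) / ln (real n)) sequentially"
    using lim by (simp add: filterlim_at_top)
  then obtain N0 where N0: "\<And>n. n \<ge> N0 \<Longrightarrow> 32 \<le> (a n + b n) / ln (real n)" by (auto simp: eventually_sequentially)
  define N where "N = max N0 2"
  have N: "n \<ge> 2" "ln (real n) > 0" "32 * ln (real n) \<le> a n + b n" if "n \<ge> N" for n
  proof -
    show n: "n \<ge> 2" using that by (simp add: N_def)
    then show l: "ln (real n) > 0" by simp
    show "32 * ln (real n) \<le> a n + b n" using N0[of n] that l by (simp add: N_def le_divide_eq)
  qed
  define c where "c n = sqrt (512 * (ln n / (a n + b n)))" for n :: nat
  \<comment> \<open>Empty below \<open>N\<close>, so that measurability holds for every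
    index.\<close>
  define A where "A n = (if n \<ge> N then {\<omega>\<in>space M. 2 * c n \<le> deviation n (a n) (b n) (\<beta> n) (\<Lambda> n \<omega>)} else {})" for n
  have "AE \<omega> in M. eventually (\<lambda>n. \<omega> \<in> space M - A n) sequentially"
  proof (rule borel_cantelli_AE1)
    fix n
    show "A n \<in> sets M"
    proof (cases "n \<ge> N")
      case True
      have [measurable]: "(\<lambda>\<omega>. deviation n (a n) (b n) (\<beta> n) (\<Lambda> n \<omega>)) \<in> borel_measurable M"
        using N(1)[OF True] by (intro measurable_compose[OF distributed_measurable[OF L] deviation_measurable]) auto
      show ?thesis using True by (simp add: A_def)
    qed (simp add: A_def)
    show "emeasure M (A n) < \<infinity>" by (simp add: less_top[symmetric])
  next
    show "summable (\<lambda>n. measure M (A n))"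
    proof (rule summable_comparison_test)
      show "summable (\<lambda>n. 16 * inverse (real n ^ 3))"
        by (intro summable_mult inverse_power_summable) auto
      show "\<exists>N. \<forall>n\<ge>N. norm (measure M (A n)) \<le> 16 * inverse (real n ^ 3)"
      proof (intro exI allI impI)
        fix n assume n: "n \<ge> N"
        have "measure M (A n) \<le> 16 / real n ^ 3"
          using deviation_probability[OF \<open>prob_space M\<close> N(1)[OF n] _ _ _ L[OF N(1)[OF n]] N(3)[OF n] c_def] ab[OF N(1)[OF n]] n
          by (simp add: A_def)
        then show "norm (measure M (A n)) \<le> 16 * inverse (real n ^ 3)" by (simp add: divide_inverse)
      qed
    qed
  qed
  then show ?thesis
  proof eventually_elim
    case (elim \<omega>)
    show ?case using elim eventually_ge_at_top[of N]
    proof eventually_elim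
      case (elim n)
      define t where "t = ln (real n) / (a n + b n)"
      have t: "0 < t" "t \<le> 1" using N(2,3)[OF elim(2)] by (auto simp: t_def divide_le_eq)
      have "deviation n (a n) (b n) (\<beta> n) (\<Lambda> n \<omega>) \<le> 2 * c n" using elim by (auto simp: A_def not_le split: if_splits)
      also have "\<dots> = 2 * sqrt 512 * sqrt t" unfolding c_def t_def[symmetric] real_sqrt_mult by simp
      \<comment> \<open>The constant 46 comes from 512 \<le> 23^2.\<close>
      also have "\<dots> \<le> 46 * sqrt t"
      proof (intro mult_right_mono)
        have "sqrt 512 \<le> 23" by (rule real_le_lsqrt) simp_all
        then show "2 * sqrt 512 \<le> 46" by simp
      qed (use t in simp)
      also have "sqrt t = t powr (1/2)" using t by (simp add: powr_half_sqrt)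
      \<comment> \<open>The square-root rate obtained is stronger than the required fourth root,
        since \<open>t \<le> 1\<close> from \<open>N\<close> on.\<close>
      also have "t powr (1/2) \<le> t powr (1/4)" using t by (intro powr_mono') auto
      finally show ?case by (simp add: t_def)
    qed
  qed
qed

theorem theorem2p2:
  fixes M :: "'w measure"
    and a b \<beta> :: "nat \<Rightarrow> real"
    and \<Lambda> :: "nat \<Rightarrow> 'w \<Rightarrow> nat \<Rightarrow> real"
  assumes "prob_space M"
    and "\<And>n. n \<ge> 2 \<Longrightarrow> a n > -1 \<and> b n > -1 \<and> \<beta> n > 0"
    and "\<And>n. n \<ge> 2 \<Longrightarrow>
           distributed M (PiM {..<n} (\<lambda>_. lborel)) (\<Lambda> n) (jacobi_density n (a n) (b n) (\<beta> n))"
  defines "D \<equiv> \<lambda>n \<omega>. Max ((\<lambda>j. \<bar>order_stat n (\<Lambda> n \<omega>) j -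
              ordered_root_half (jacobiP n ((2 * a n + 2) / \<beta> n - 1) ((2 * b n + 2) / \<beta> n - 1)) j\<bar>)
              ` {1..n})"
  shows
    "(filterlim (\<lambda>n. (a n + b n) / ln (real n)) at_top sequentially \<longrightarrow>
       (\<exists>S :: 'w \<Rightarrow> ereal. S \<in> borel_measurable M \<and> (AE \<omega> in M. S \<omega> < \<infinity>) \<and>
          (\<forall>\<omega>\<in>space M. \<forall>n\<ge>2. a n + b n > 0 \<longrightarrow>
             ereal (D n \<omega>) \<le> ereal ((ln (real n) / (a n + b n)) powr (1/4)) * S \<omega>)))
     \<and>
     (liminf (\<lambda>n. ereal ((a n + b n) / real n)) > 0 \<longrightarrow>
       (\<exists>S' :: 'w \<Rightarrow> ereal. S' \<in> borel_measurable M \<and> (AE \<omega> in M. S' \<omega> < \<infinity>) \<and>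
          (AE \<omega> in M. \<forall>n\<ge>2.
             ereal (D n \<omega>) \<le> ereal ((ln (real n) / real n) powr (1/4)) * S' \<omega>)))"
proof -
  have D: "D n \<omega> = deviation n (a n) (b n) (\<beta> n) (\<Lambda> n \<omega>)" for n \<omega> by (simp add: D_def deviation_def)
  have Dm: "D n \<in> borel_measurable M" if "n \<ge> 2" for n
    unfolding D using that
    by (intro measurable_compose[OF distributed_measurable[OF assms(3)] deviation_measurable]) auto
  have ev: "AE \<omega> in M. eventually (\<lambda>n. D n \<omega> \<le> 46 * (ln (real n) / (a n + b n)) powr (1/4)) sequentially"
    if "filterlim (\<lambda>n. (a n + b n) / ln (real n)) at_top sequentially"
    unfolding D by (rule deviation_eventually_le) (use assms(1-3) that in auto)
  show ?thesis
  proof (intro conjI impI)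
    assume lim: "filterlim (\<lambda>n. (a n + b n) / ln (real n)) at_top sequentially"
    \<comment> \<open>On this index set the rate is positive, so the ratios defining the dominating
      variable make sense.\<close>
    have "\<exists>S :: 'w \<Rightarrow> ereal. S \<in> borel_measurable M \<and> (AE \<omega> in M. S \<omega> < \<infinity>) \<and>
      (\<forall>\<omega>\<in>space M. \<forall>n\<in>{n. n \<ge> 2 \<and> a n + b n > 0}. ereal (D n \<omega>) \<le> ereal ((ln (real n) / (a n + b n)) powr (1/4)) * S \<omega>)"
    proof (rule ex_dominating_random_variable)
      show "AE \<omega> in M. eventually (\<lambda>n. n \<in> {n. n \<ge> 2 \<and> a n + b n > 0} \<longrightarrow> D n \<omega> \<le> 46 * (ln (real n) / (a n + b n)) powr (1/4)) sequentially"
        using ev[OF lim] by (rule AE_mp) (auto elim: eventually_mono)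
    qed (use Dm in auto)
    then show "\<exists>S :: 'w \<Rightarrow> ereal. S \<in> borel_measurable M \<and> (AE \<omega> in M. S \<omega> < \<infinity>) \<and>
          (\<forall>\<omega>\<in>space M. \<forall>n\<ge>2. a n + b n > 0 \<longrightarrow>
             ereal (D n \<omega>) \<le> ereal ((ln (real n) / (a n + b n)) powr (1/4)) * S \<omega>)" by auto
  next
    assume "liminf (\<lambda>n. ereal ((a n + b n) / real n)) > 0"
    \<comment> \<open>A number strictly between 0 and the limit inferior gives the linear lower
      bound s n \<le> a + b for large \<open>n\<close>.\<close>
    then obtain s where s: "0 < ereal s" "ereal s < liminf (\<lambda>n. ereal ((a n + b n) / real n))"
      using ereal_dense2 by blast
    then have s0: "s > 0" by simp
    have lin: "eventually (\<lambda>n. s * real n \<le> a n + b n \<and> n \<ge> 2) sequentially"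
      using less_LiminfD[OF s(2)] eventually_ge_at_top[of 2]
      by eventually_elim (simp add: less_divide_eq)
    have lim: "filterlim (\<lambda>n. (a n + b n) / ln (real n)) at_top sequentially"
    proof (rule filterlim_at_top_mono)
      show "filterlim (\<lambda>n. s * (real n / ln (real n))) at_top sequentially"
      proof (rule filterlim_tendsto_pos_mult_at_top[OF tendsto_const s0])
        show "filterlim (\<lambda>n. real n / ln (real n)) at_top sequentially" by real_asymp
      qed
      show "eventually (\<lambda>n. s * (real n / ln (real n)) \<le> (a n + b n) / ln (real n)) sequentially"
        using lin by eventually_elim (simp add: divide_right_mono)
    qed
    \<comment> \<open>The factor (1 / s)^(1/4) is the price of replacing a + b by n in the
      rate.\<close>
    define K where "K = 46 * (1 / s) powr (1/4)"
    have "\<exists>S :: 'w \<Rightarrow> ereal. S \<in> borel_measurable M \<and> (AE \<omega> in M. S \<omega> < \<infinity>) \<and>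
      (\<forall>\<omega>\<in>space M. \<forall>n\<in>{2..}. ereal (D n \<omega>) \<le> ereal ((ln (real n) / real n) powr (1/4)) * S \<omega>)"
    proof (rule ex_dominating_random_variable)
      show "AE \<omega> in M. eventually (\<lambda>n. n \<in> {2..} \<longrightarrow> D n \<omega> \<le> K * (ln (real n) / real n) powr (1/4)) sequentially"
        using ev[OF lim]
      proof eventually_elim
        case (elim \<omega>)
        show ?case using elim lin
        proof eventually_elim
          case (elim n)
          have pos: "0 < s * real n" "0 < a n + b n" "0 \<le> ln (real n)"
          proof -
            show "0 < s * real n" using s0 elim(2) by simp
            then show "0 < a n + b n" using elim(2) by linarith
            show "0 \<le> ln (real n)" using elim(2) by simp
          qed
          have "ln (real n) / (a n + b n) \<le> ln (real n) / (s * real n)"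
            using elim(2) pos s0 by (intro divide_left_mono mult_pos_pos) auto
          also have "\<dots> = 1 / s * (ln (real n) / real n)" by simp
          finally have "(ln (real n) / (a n + b n)) powr (1/4) \<le> (1 / s * (ln (real n) / real n)) powr (1/4)"
            using pos s0 by (intro powr_mono2) simp_all
          also have "\<dots> = (1 / s) powr (1/4) * (ln (real n) / real n) powr (1/4)"
            by (rule powr_mult)
          finally show ?case using elim(1) by (simp add: K_def)
        qed
      qed
    qed (use Dm in auto)
    then show "\<exists>S' :: 'w \<Rightarrow> ereal. S' \<in> borel_measurable M \<and> (AE \<omega> in M. S' \<omega> < \<infinity>) \<and>
          (AE \<omega> in M. \<forall>n\<ge>2. ereal (D n \<omega>) \<le> ereal ((ln (real n) / real n) powr (1/4)) * S' \<omega>)"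
      by (auto intro!: AE_I2)
  qed
qed

end
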